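(* Let $s\ge r$ be positive integers, let $b_1,b_2$ be positive constants, and let $\mathcal{A}$ be a fixed non-trivial pattern with $r$ distinct entries (that is, $\mathcal{A}$ is a partition of $[k]\times[\ell]$, for some positive integers $k,\ell$, into exactly $r$ nonempty classes, and $r\ge 2$). Then, for positive integers $m,n$ with $b_1\le m/n\le b_2$, $$ f(m,n;s,\mathcal{A})=(1+o(1))\left(\frac{s-r+1}{s}\right)mn, $$ where $o(1)$ tends to $0$ as $m,n\to\infty$ subject to $b_1\le m/n\le b_2$, with $s,r,b_1,b_2,\mathcal{A}$ fixed.
   Context: Write $[m]=\{1,\dots,m\}$. A pattern $\mathcal{A}=\{A_1,\dots,A_r\}$ is a partition of $[k]\times[\ell]$ into $r$ nonempty classes; it is called trivial if it has exactly one class, and non-trivial otherwise. A $k\times\ell$ matrix $A=(a_{ij})$ has pattern $\mathcal{A}$ if, for all positions, $a_{ij}=a_{i'j'}$ if and only if $(i,j),(i',j')\in A_t$ for some $t\in\{1,\dots,r\}$. A $k\times\ell$ matrix $B$ is a submatrix of an $m\times n$ matrix $A$ if there are distinct indices $i_1,\dots,i_k\in[m]$ and distinct indices $j_1,\dots,j_\ell\in[n]$ (not required to be in increasing order) such that $B(\alpha,\beta)=A(i_\alpha,j_\beta)$ for all $1\le\alpha\le k$, $1\le\beta\le\ell$. A matrix has subpattern $\mathcal{A}$ if some submatrix of it has pattern $\mathcal{A}$. $\mathcal{M}(m,n;s)$ denotes the set of all $m\times n$ matrices with $s$ distinct entries ($s\le mn$). $\mathrm{Forb}(m,n;s,\mathcal{A})$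 denotes the set of all $m\times n$ matrices with at most $s$ distinct entries that do not have subpattern $\mathcal{A}$. For two matrices $A,B$ of the same dimensions, $\mathrm{Dist}(A,B)$ is the number of positions in which they differ, and for a class $\mathcal{F}$ of matrices of the same dimensions as $A$, $\mathrm{Dist}(A,\mathcal{F})=\min\{\mathrm{Dist}(A,F):F\in\mathcal{F}\}$. Finally, $$ f(m,n;s,\mathcal{A})=\max\{\mathrm{Dist}(A,\mathrm{Forb}(m,n;s,\mathcal{A})) : A\in\mathcal{M}(m,n;s)\}. $$ *)

theory Defs
  imports Complex_Main "HOL-Library.Disjoint_Sets" "Jordan_Normal_Form.Matrix"
begin

text \<open>Matrix indices start at 0, so \<open>{..<m}\<close> plays the role of \<open>[m]\<close>.  The type of the
  entries is the alphabet of symbols; it is kept arbitrary.\<close>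

definition is_pattern :: "nat \<Rightarrow> nat \<Rightarrow> nat \<Rightarrow> (nat \<times> nat) set set \<Rightarrow> bool" where
  "is_pattern k l r P \<longleftrightarrow> partition_on ({..<k} \<times> {..<l}) P \<and> card P = r"

definition trivial_pattern :: "(nat \<times> nat) set set \<Rightarrow> bool" where
  "trivial_pattern P \<longleftrightarrow> card P = 1"

definition has_pattern :: "nat \<Rightarrow> nat \<Rightarrow> (nat \<times> nat) set set \<Rightarrow> 'a mat \<Rightarrow> bool" where
  "has_pattern k l P B \<longleftrightarrow> B \<in> carrier_mat k l \<and>
     (\<forall>p \<in> {..<k} \<times> {..<l}. \<forall>q \<in> {..<k} \<times> {..<l}.
        B $$ p = B $$ q \<longleftrightarrow> (\<exists>T \<in> P. p \<in> T \<and> q \<in> T))"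

text \<open>The selected rows and columns are distinct but need not be in increasing order.\<close>

definition is_submatrix :: "'a mat \<Rightarrow> 'a mat \<Rightarrow> bool" where
  "is_submatrix B A \<longleftrightarrow>
     (\<exists>\<rho> \<gamma>. inj_on \<rho> {..<dim_row B} \<and> \<rho> ` {..<dim_row B} \<subseteq> {..<dim_row A} \<and>
            inj_on \<gamma> {..<dim_col B} \<and> \<gamma> ` {..<dim_col B} \<subseteq> {..<dim_col A} \<and>
            (\<forall>\<alpha> < dim_row B. \<forall>\<beta> < dim_col B. B $$ (\<alpha>, \<beta>) = A $$ (\<rho> \<alpha>, \<gamma> \<beta>)))"

definition has_subpattern :: "nat \<Rightarrow> nat \<Rightarrow> (nat \<times> nat) set set \<Rightarrow> 'a mat \<Rightarrow> bool" where
  "has_subpattern k l P A \<longleftrightarrow> (\<exists>B. is_submatrix B A \<and> has_pattern k l P B)"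

definition matrices :: "nat \<Rightarrow> nat \<Rightarrow> nat \<Rightarrow> 'a mat set" where
  "matrices m n s = {A \<in> carrier_mat m n. card (elements_mat A) = s}"

definition Forb :: "nat \<Rightarrow> nat \<Rightarrow> nat \<Rightarrow> nat \<Rightarrow> nat \<Rightarrow> (nat \<times> nat) set set \<Rightarrow> 'a mat set" where
  "Forb m n s k l P =
     {F \<in> carrier_mat m n. card (elements_mat F) \<le> s \<and> \<not> has_subpattern k l P F}"

definition mat_dist :: "'a mat \<Rightarrow> 'a mat \<Rightarrow> nat" where
  "mat_dist A B = card {(i, j). i < dim_row A \<and> j < dim_col A \<and> A $$ (i, j) \<noteq> B $$ (i, j)}"

text \<open>Distances between \<open>m \<times> n\<close> matrices are at most \<open>m * n\<close>, so \<open>Min\<close> and \<open>Max\<close> below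
  range over finite sets even when the alphabet is infinite.  For \<open>m, n, s > 0\<close> and a non-trivial
  pattern, \<open>Forb\<close> contains the constant matrices, so the minimum is attained; the maximum is
  meaningful when \<open>s \<le> m * n\<close> and the alphabet has at least \<open>s\<close> symbols.\<close>

definition class_dist :: "'a mat \<Rightarrow> 'a mat set \<Rightarrow> nat" where
  "class_dist A \<F> = Min (mat_dist A ` \<F>)"

definition max_forb_dist ::
  "'a itself \<Rightarrow> nat \<Rightarrow> nat \<Rightarrow> nat \<Rightarrow> nat \<Rightarrow> nat \<Rightarrow> (nat \<times> nat) set set \<Rightarrow> nat" where
  "max_forb_dist _ m n s k l P =
     Max ((\<lambda>A. class_dist A (Forb m n s k l P)) ` (matrices m n s :: 'a mat set))"

text \<open>The filter ``\<open>m, n \<rightarrow> \<infinity>\<close> subject to \<open>b1 \<le> m/n \<le> b2\<close>''.\<close>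

definition bounded_ratio_filter :: "real \<Rightarrow> real \<Rightarrow> (nat \<times> nat) filter" where
  "bounded_ratio_filter b1 b2 =
     inf (at_top \<times>\<^sub>F at_top) (principal {(m, n). b1 \<le> real m / real n \<and> real m / real n \<le> b2})"

end

theory Submission
  imports Defs "HOL-Real_Asymp.Real_Asymp"
begin

text \<open>Write \<open>t = r - 1\<close>. For the upper bound, keep the \<open>t\<close> most frequent symbols of a matrix and
  overwrite everything else by one of them: \<open>r\<close> different symbols are no longer available.

  For the lower bound it suffices to find, for each \<open>\<epsilon> > 0\<close>, one \<open>n \<times> N\<close> matrix at distance at
  least \<open>((s - t) / s - \<epsilon>) n N\<close> from \<open>Forb\<close>, since every block of a periodic tiling by this matrix
  has to be repaired separately. Take the matrix whose columns are all \<open>s ^ n\<close> words of length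
  \<open>n\<close>. If \<open>F\<close> avoids the pattern, the set \<open>V\<close> of its columns shatters no large set of rows with a
  common set of \<open>r\<close> symbols, so that only \<open>p = n ^ O(1)\<close> tests are shattered by \<open>V\<close>. Reading the
  rows one after the other and restricting \<open>V\<close> only when a column leaves a list of \<open>t\<close> favoured
  symbols, one covers \<open>V\<close> by \<open>exp (o(n))\<close> boxes with \<open>t\<close> symbols in all but \<open>O(log p)\<close> coordinates. A
  random word agrees with a box in about \<open>t n / s\<close> coordinates, and an exponential moment absorbs
  the maximum over the boxes.\<close>

section \<open>Shattering by sets of words\<close>

definition words :: "'a set \<Rightarrow> nat \<Rightarrow> 'a list set" where
  "words S n = {xs. set xs \<subseteq> S \<and> length xs = n}"

lemma finite_words: "finite S \<Longrightarrow> finite (words S n)"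
  unfolding words_def by (rule finite_lists_length_eq)

lemma card_words: "finite S \<Longrightarrow> card (words S n) = card S ^ n"
  unfolding words_def by (rule card_lists_length_eq)

lemma words_0: "words S 0 = {[]}"
  by (auto simp: words_def)

lemma Cons_in_words: "x # xs \<in> words S (Suc n) \<longleftrightarrow> x \<in> S \<and> xs \<in> words S n"
  by (auto simp: words_def)

lemma words_Suc: "words S (Suc n) = (\<lambda>(x, xs). x # xs) ` (S \<times> words S n)"
  by (auto simp: words_def length_Suc_conv)

lemma sum_words_Suc: "(\<Sum>w\<in>words S (Suc n). f w) = (\<Sum>x\<in>S. \<Sum>w\<in>words S n. f (x # w))"
proof -
  have "inj_on (\<lambda>(x, xs). x # xs) (S \<times> words S n)"
    by (auto simp: inj_on_def)
  then have "(\<Sum>w\<in>words S (Suc n). f w) = (\<Sum>(x, w)\<in>S \<times> words S n. f (x # w))"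
    unfolding words_Suc by (simp add: sum.reindex case_prod_unfold)
  then show ?thesis
    by (simp add: sum.cartesian_product)
qed

definition link :: "'a \<Rightarrow> 'a list set \<Rightarrow> 'a list set" where
  "link c V = {w. c # w \<in> V}"

definition shadow :: "'a list set \<Rightarrow> 'a list set" where
  "shadow V = {w. \<exists>c. c # w \<in> V}"

lemma link_words: "V \<subseteq> words S (Suc n) \<Longrightarrow> link c V \<subseteq> words S n"
  by (auto simp: link_def Cons_in_words dest!: subsetD)

lemma shadow_words: "V \<subseteq> words S (Suc n) \<Longrightarrow> shadow V \<subseteq> words S n"
  by (auto simp: shadow_def Cons_in_words dest!: subsetD)

text \<open>A test is a list with an entry for each coordinate: \<open>None\<close> leaves the coordinate free,
  \<open>Some R\<close> demands that all symbols of \<open>R\<close> occur there, independently of the other coordinates.\<close>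

fun shatters :: "'a list set \<Rightarrow> 'a set option list \<Rightarrow> bool" where
  "shatters V [] \<longleftrightarrow> [] \<in> V"
| "shatters V (None # \<tau>) \<longleftrightarrow> shatters (shadow V) \<tau>"
| "shatters V (Some R # \<tau>) \<longleftrightarrow> (\<forall>c\<in>R. shatters (link c V) \<tau>)"

lemma shatters_mono: "V \<subseteq> W \<Longrightarrow> shatters V \<tau> \<Longrightarrow> shatters W \<tau>"
proof (induction V \<tau> arbitrary: W rule: shatters.induct)
  case (2 V \<tau>)
  then have "shadow V \<subseteq> shadow W" by (auto simp: shadow_def)
  with 2 show ?case by auto
next
  case (3 V R \<tau>)
  then have "link c V \<subseteq> link c W" for c by (auto simp: link_def)
  with 3 show ?case by auto
qed auto

text \<open>Induction along the test: a demanding coordinate follows the \<open>link\<close> of the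
  chosen symbol, a free one takes whatever symbol witnesses membership in \<open>shadow\<close>, so
  that symbol may vary with \<open>g\<close>. This turns the recursive form of shattering into
  columns with prescribed entries.\<close>

lemma shatters_choice:
  assumes "shatters V \<tau>"
    and "\<And>i R. i < length \<tau> \<Longrightarrow> \<tau> ! i = Some R \<Longrightarrow> g i \<in> R"
  shows "\<exists>v\<in>V. length v = length \<tau> \<and> (\<forall>i<length \<tau>. \<tau> ! i \<noteq> None \<longrightarrow> v ! i = g i)"
  using assms
proof (induction V \<tau> arbitrary: g rule: shatters.induct)
  case (1 V)
  then show ?case by auto
next
  case (2 V \<tau>)
  have "\<And>i R. i < length \<tau> \<Longrightarrow> \<tau> ! i = Some R \<Longrightarrow> g (Suc i) \<in> R"
    using "2.prems"(2)[of "Suc i" for i] by auto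
  with "2.IH"[of "\<lambda>i. g (Suc i)"] "2.prems"(1) obtain v where v: "v \<in> shadow V"
    "length v = length \<tau>" "\<forall>i<length \<tau>. \<tau> ! i \<noteq> None \<longrightarrow> v ! i = g (Suc i)"
    by auto
  from v(1) obtain c where "c # v \<in> V" by (auto simp: shadow_def)
  then show ?case
    using v by (intro bexI[of _ "c # v"]) (auto simp: nth_Cons split: nat.splits)
next
  case (3 V R \<tau>)
  have g0: "g 0 \<in> R"
    using "3.prems"(2)[of 0] by auto
  have "\<And>i R. i < length \<tau> \<Longrightarrow> \<tau> ! i = Some R \<Longrightarrow> g (Suc i) \<in> R"
    using "3.prems"(2)[of "Suc i" for i] by auto
  with "3.IH"[of "g 0" "\<lambda>i. g (Suc i)"] "3.prems"(1) g0 obtain v where v: "v \<in> link (g 0) V"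
    "length v = length \<tau>" "\<forall>i<length \<tau>. \<tau> ! i \<noteq> None \<longrightarrow> v ! i = g (Suc i)"
    by auto
  then have "g 0 # v \<in> V" by (auto simp: link_def)
  then show ?case
    using v by (intro bexI[of _ "g 0 # v"]) (auto simp: nth_Cons split: nat.splits)
qed

definition tests :: "'a set \<Rightarrow> nat \<Rightarrow> nat \<Rightarrow> 'a set option list set" where
  "tests S r n = words (insert None (Some ` {R. R \<subseteq> S \<and> card R = r})) n"

text \<open>The number of these tests is the potential of the induction in
  \<open>sum_best_le\<close>, in the role that the number of shattered sets has in arguments of
  Sauer-Shelah type.\<close>

definition shattered :: "'a set \<Rightarrow> nat \<Rightarrow> nat \<Rightarrow> 'a list set \<Rightarrow> 'a set option list set" where
  "shattered S r n V = {\<tau> \<in> tests S r n. shatters V \<tau>}"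

lemma finite_shattered: "finite S \<Longrightarrow> finite (shattered S r n V)"
  unfolding shattered_def tests_def
  by (rule finite_subset[OF _ finite_words, of _ "insert None (Some ` {R. R \<subseteq> S \<and> card R = r})" n]) auto

lemma shattered_mono: "V \<subseteq> W \<Longrightarrow> shattered S r n V \<subseteq> shattered S r n W"
  by (auto simp: shattered_def intro: shatters_mono)

text \<open>The test that leaves every coordinate free is always shattered. Hence a vanishing
  potential, the case of an exhausted budget in \<open>sum_best_le\<close>, forces
  \<open>V = {}\<close>.\<close>

lemma shattered_nonempty:
  assumes "v \<in> V" "V \<subseteq> words S n"
  shows "shattered S r n V \<noteq> {}"
proof -
  have "shatters V (replicate (length v) None)" if "v \<in> V" for v and V :: "'a list set"
    using that
  proof (induction v arbitrary: V)
    case (Cons x v)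
    then have "v \<in> shadow V" by (auto simp: shadow_def)
    then show ?case using Cons.IH by simp
  qed auto
  moreover have "length v = n"
    using assms by (auto simp: words_def)
  ultimately have "replicate n None \<in> shattered S r n V"
    using assms by (auto simp: shattered_def tests_def words_def)
  then show ?thesis by blast
qed

text \<open>Double counting of pairs of a symbol of \<open>R\<close> and a test shattered by its
  link. All these tests lie in \<open>?X\<close>, and each is counted at most \<open>t\<close> times
  unless all \<open>t + 1\<close> links shatter it, which puts it into \<open>?Y\<close>. Prefixing
  \<open>None\<close> to \<open>?X\<close> and \<open>Some R\<close> to \<open>?Y\<close> gives
  disjoint families of tests shattered by \<open>V\<close>.\<close>

lemma sum_card_shattered_link:
  assumes S: "finite S" and R: "R \<subseteq> S" "card R = Suc t" and "1 \<le> t"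
  shows "(\<Sum>c\<in>R. card (shattered S (Suc t) n (link c V))) \<le> t * card (shattered S (Suc t) (Suc n) V)"
proof -
  let ?X = "shattered S (Suc t) n (shadow V)"
  let ?Z = "\<lambda>c. shattered S (Suc t) n (link c V)"
  let ?Y = "{\<tau> \<in> ?X. \<forall>c\<in>R. \<tau> \<in> ?Z c}"
  have finX: "finite ?X" and finY: "finite ?Y"
    using S by (auto simp: finite_shattered)
  have finR: "finite R"
    using R card.infinite by force
  have ZX: "?Z c \<subseteq> ?X" for c
    by (rule shattered_mono) (auto simp: link_def shadow_def)
  have "(\<Sum>c\<in>R. card (?Z c)) = (\<Sum>c\<in>R. \<Sum>\<tau>\<in>?X. of_bool (\<tau> \<in> ?Z c))"
    using ZX finX by (intro sum.cong) (auto simp: Int_absorb1 Int_commute)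
  also have "\<dots> = (\<Sum>\<tau>\<in>?X. \<Sum>c\<in>R. of_bool (\<tau> \<in> ?Z c))"
    by (rule sum.swap)
  also have "\<dots> \<le> (\<Sum>\<tau>\<in>?X. t + of_bool (\<tau> \<in> ?Y))"
  proof (rule sum_mono)
    fix \<tau> assume "\<tau> \<in> ?X"
    have le: "(\<Sum>c\<in>R. of_bool (\<tau> \<in> ?Z c)) = card {c\<in>R. \<tau> \<in> ?Z c}"
      using finR by (simp add: Collect_conj_eq)
    show "(\<Sum>c\<in>R. of_bool (\<tau> \<in> ?Z c)) \<le> t + of_bool (\<tau> \<in> ?Y)"
    proof (cases "\<tau> \<in> ?Y")
      case True
      have "card {c\<in>R. \<tau> \<in> ?Z c} \<le> card R"
        using finR by (intro card_mono) auto
      with True le R show ?thesis by simp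
    next
      case False
      then have "{c\<in>R. \<tau> \<in> ?Z c} \<subset> R"
        using \<open>\<tau> \<in> ?X\<close> by auto
      then have "card {c\<in>R. \<tau> \<in> ?Z c} < card R"
        using finR by (rule psubset_card_mono[rotated])
      with le R show ?thesis by simp
    qed
  qed
  also have "\<dots> = t * card ?X + card (?X \<inter> {\<tau>. \<tau> \<in> ?Y})"
    using finX by (simp only: sum.distrib sum_constant sum_of_bool_eq of_nat_id mult.commute)
  also have "?X \<inter> {\<tau>. \<tau> \<in> ?Y} = ?Y"
    by blast
  also have "t * card ?X + card ?Y \<le> t * (card ?X + card ?Y)"
    using \<open>1 \<le> t\<close> by (simp add: distrib_left)
  also have "card ?X + card ?Y = card ((#) None ` ?X) + card ((#) (Some R) ` ?Y)"
    by (simp add: card_image)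
  also have "\<dots> = card ((#) None ` ?X \<union> (#) (Some R) ` ?Y)"
    using finX finY by (subst card_Un_disjoint) auto
  also have "\<dots> \<le> card (shattered S (Suc t) (Suc n) V)"
    using R by (intro card_mono finite_shattered S)
      (auto simp: shattered_def tests_def Cons_in_words)
  finally show ?thesis by simp
qed

lemma card_shattered_shadow:
  assumes "finite S"
  shows "card (shattered S r n (shadow V)) \<le> card (shattered S r (Suc n) V)"
proof -
  have "(#) None ` shattered S r n (shadow V) \<subseteq> shattered S r (Suc n) V"
    by (auto simp: shattered_def tests_def Cons_in_words)
  then have "card ((#) None ` shattered S r n (shadow V)) \<le> card (shattered S r (Suc n) V)"
    using assms by (intro card_mono finite_shattered)
  then show ?thesis by (simp add: card_image)
qed

section \<open>Exponential moments of the best agreement\<close>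

definition agree :: "'a list \<Rightarrow> 'a list \<Rightarrow> nat" where
  "agree xs ys = length (filter (\<lambda>(x, y). x = y) (zip xs ys))"

lemma agree_Cons: "agree (x # xs) (y # ys) = of_bool (x = y) + agree xs ys"
  by (simp add: agree_def)

lemma agree_eq_card:
  assumes "length xs = n" "length ys = n"
  shows "agree xs ys = card {i. i < n \<and> xs ! i = ys ! i}"
  using assms unfolding agree_def length_filter_conv_card
  by (intro arg_cong[of _ _ card]) auto

text \<open>Exponentiating the agreement allows a maximum over cases to be replaced by a sum. The
  inserted \<open>0\<close> is the value for \<open>V = {}\<close>, which occurs among the
  links.\<close>

definition best :: "real \<Rightarrow> 'a list set \<Rightarrow> 'a list \<Rightarrow> real" where
  "best b V a = Max (insert 0 ((\<lambda>v. b ^ agree a v) ` V))"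

lemma best_ge: "finite V \<Longrightarrow> v \<in> V \<Longrightarrow> b ^ agree a v \<le> best b V a"
  by (simp add: best_def)

lemma best_nonneg: "finite V \<Longrightarrow> 0 \<le> best b V a"
  by (simp add: best_def)

lemma best_le: "finite V \<Longrightarrow> 0 \<le> u \<Longrightarrow> (\<And>v. v \<in> V \<Longrightarrow> b ^ agree a v \<le> u) \<Longrightarrow> best b V a \<le> u"
  by (auto simp: best_def)

text \<open>Split by the first symbol \<open>c\<close> of the competing word. For \<open>c\<close>
  in \<open>R\<close>, agreement with \<open>x\<close> requires \<open>x\<close> in
  \<open>R\<close>, and the rest of the word lies in the shadow, one set for all such
  \<open>c\<close>. Every other \<open>c\<close> pays a full factor \<open>b\<close> and has its own
  term for its link.\<close>

lemma best_Cons: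
  assumes "1 \<le> b" "finite S" "V \<subseteq> words S (Suc n)"
  shows "best b V (x # a) \<le> b ^ of_bool (x \<in> R) * best b (shadow V) a
           + (\<Sum>c\<in>S - R. b * best b (link c V) a)"
proof -
  have fin: "finite V" "finite (shadow V)" "finite (link c V)" for c
    using assms finite_words finite_subset shadow_words link_words by metis+
  have nn: "0 \<le> (\<Sum>c\<in>S - R. b * best b (link c V) a)"
    using assms fin by (intro sum_nonneg mult_nonneg_nonneg best_nonneg) auto
  have nn': "0 \<le> b ^ of_bool (x \<in> R) * best b (shadow V) a"
    using assms fin by (intro mult_nonneg_nonneg best_nonneg) auto
  show ?thesis
  proof (rule best_le)
    fix v assume "v \<in> V"
    then obtain c w where v: "v = c # w" "c \<in> S" "c # w \<in> V"
      using assms(3) by (auto simp: words_Suc)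
    show "b ^ agree (x # a) v \<le> b ^ of_bool (x \<in> R) * best b (shadow V) a
           + (\<Sum>c\<in>S - R. b * best b (link c V) a)"
    proof (cases "c \<in> R")
      case True
      have "b ^ agree (x # a) v \<le> b ^ of_bool (x \<in> R) * b ^ agree a w"
        using assms(1) True by (auto simp: v agree_Cons)
      also have "\<dots> \<le> b ^ of_bool (x \<in> R) * best b (shadow V) a"
        using assms(1) v fin by (intro mult_left_mono best_ge) (auto simp: shadow_def)
      finally show ?thesis using nn by simp
    next
      case False
      have "b ^ agree (x # a) v \<le> b * b ^ agree a w"
        using assms(1) by (auto simp: v agree_Cons)
      also have "\<dots> \<le> b * best b (link c V) a"
        using assms(1) v fin by (intro mult_left_mono best_ge) (auto simp: link_def)
      also have "\<dots> \<le> (\<Sum>c\<in>S - R. b * best b (link c V) a)"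
        using False v assms fin
        by (intro member_le_sum mult_nonneg_nonneg best_nonneg) auto
      finally show ?thesis using nn' by simp
    qed
  qed (use nn nn' fin in auto)
qed

text \<open>One step of a recursion in which either the budget \<open>Suc M\<close> is kept or one
  unit of it is spent at cost \<open>C\<close>. It serves both \<open>sum_best_le\<close> and
  \<open>card_words_few\<close>.\<close>

lemma power_Suc_le_power_add:
  fixes x C :: "'a :: linordered_semidom"
  assumes "0 \<le> x" "0 \<le> C"
  shows "x ^ Suc M + C * x ^ M \<le> (x + C) ^ Suc M"
proof -
  have "x ^ Suc M + C * x ^ M = (x + C) * x ^ M"
    by (simp add: algebra_simps)
  also have "\<dots> \<le> (x + C) * (x + C) ^ M"
    using assms by (intro mult_left_mono power_mono) auto
  finally show ?thesis by simp
qed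

text \<open>A coordinate is handled by a list \<open>R\<close> of at most \<open>t\<close> favoured symbols; a word leaving the
  list multiplies the number of shattered tests by at most \<open>t / (t + 1)\<close>, which
  can happen fewer than \<open>M\<close> times.\<close>

lemma sum_best_le:
  fixes b :: real and T S :: "'a set"
  assumes b: "1 \<le> b" and T: "finite T" "card T = s" "0 < s" and S: "finite S" "card S \<le> s"
    and t: "1 \<le> t"
    and V: "V \<subseteq> words S n" and M: "card (shattered S (Suc t) n V) * t ^ M < Suc t ^ M"
  shows "(\<Sum>a\<in>words T n. best b V a)
           \<le> (real s + real t * (b - 1)) ^ n * (real s ^ 2 * b * real n + 1) ^ M"
  using V M
proof (induction n arbitrary: V M)
  case 0
  have "finite V"
    using 0 finite_subset by (auto simp: words_0)
  then have "best b V [] \<le> 1"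
    by (rule best_le) (use 0 in \<open>auto simp: words_0 agree_def dest!: subsetD\<close>)
  then show ?case by (simp add: words_0)
next
  case (Suc n)
  \<comment> \<open>In \<open>C\<close>, one factor \<open>s\<close> counts the first symbols of
    \<open>a\<close>, the other the first symbols outside \<open>R\<close> of the words in
    \<open>V\<close>, and \<open>b\<close> pays for a possible agreement. \<open>Q\<close> is the
    sum of \<open>b ^ of_bool (c \<in> R)\<close> over the first symbols \<open>c\<close>, for a
    list \<open>R\<close> of \<open>t\<close> symbols of \<open>T\<close>.\<close>
  define C where "C = real s ^ 2 * b"
  define Q where "Q = real s + real t * (b - 1)"
  define x where "x = C * real n + 1"
  have C: "0 \<le> C" and x: "0 \<le> x" and Q: "1 \<le> Q"
    using b T(3) by (auto simp: C_def Q_def x_def intro: add_increasing2)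
  have finV: "finite V"
    using Suc.prems S finite_words finite_subset by metis
  let ?\<Psi> = "card (shattered S (Suc t) (Suc n) V)"
  show ?case
  proof (cases M)
    case 0
    \<comment> \<open>Without budget, the hypothesis says that the potential is less than 1.\<close>
    then have "shattered S (Suc t) (Suc n) V = {}"
      using Suc.prems S by (simp add: finite_shattered)
    then have "V = {}"
      using shattered_nonempty Suc.prems(1) by blast
    then have "(\<Sum>a\<in>words T (Suc n). best b V a) = 0"
      by (simp add: best_def)
    then show ?thesis
      using b C Q by (simp add: 0 flip: Q_def)
  next
    case (Suc M')
    \<comment> \<open>A favoured symbol is one whose link keeps more than the fraction
      \<open>t / (t + 1)\<close> of the potential. By \<open>sum_card_shattered_link\<close>, there
      cannot be \<open>t + 1\<close> of them.\<close>
    define R where "R = {c \<in> S. t * ?\<Psi> < Suc t * card (shattered S (Suc t) n (link c V))}"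
    have finR: "finite R" and RS: "R \<subseteq> S"
      using S by (auto simp: R_def)
    have cardR: "card R \<le> t"
    proof (rule ccontr)
      assume "\<not> card R \<le> t"
      then obtain R' where R': "R' \<subseteq> R" "card R' = Suc t" "finite R'"
        by (metis not_less_eq_eq obtain_subset_with_card_n)
      have "Suc t * (t * ?\<Psi>) = (\<Sum>c\<in>R'. t * ?\<Psi>)"
        using R' by simp
      also have "\<dots> < (\<Sum>c\<in>R'. Suc t * card (shattered S (Suc t) n (link c V)))"
        using R' by (intro sum_strict_mono) (auto simp: R_def)
      also have "\<dots> = Suc t * (\<Sum>c\<in>R'. card (shattered S (Suc t) n (link c V)))"
        by (simp only: sum_distrib_left)
      also have "\<dots> \<le> Suc t * (t * ?\<Psi>)"
        using sum_card_shattered_link[OF S(1) _ R'(2) t] R'(1) RS by (intro mult_le_mono) auto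
      finally show False by simp
    qed
    \<comment> \<open>The favoured symbols are treated together through the shadow, whose potential
      is no larger, so the budget stays \<open>M\<close>.\<close>
    have IH1: "(\<Sum>a\<in>words T n. best b (shadow V) a) \<le> Q ^ n * x ^ M"
    proof -
      have "card (shattered S (Suc t) n (shadow V)) * t ^ M \<le> ?\<Psi> * t ^ M"
        by (intro mult_right_mono card_shattered_shadow S) auto
      with Suc.prems(2) have "card (shattered S (Suc t) n (shadow V)) * t ^ M < Suc t ^ M"
        by (rule order.strict_trans1[rotated])
      from Suc.IH[OF shadow_words[OF Suc.prems(1)] this] show ?thesis
        by (simp add: Q_def x_def C_def)
    qed
    have IH2: "(\<Sum>a\<in>words T n. best b (link c V) a) \<le> Q ^ n * x ^ M'" if "c \<in> S - R" for c
    proof -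
      have "Suc t * card (shattered S (Suc t) n (link c V)) \<le> t * ?\<Psi>"
        using that by (auto simp: R_def)
      then have "Suc t * card (shattered S (Suc t) n (link c V)) * t ^ M' \<le> t * ?\<Psi> * t ^ M'"
        by (intro mult_right_mono) auto
      also have "\<dots> < Suc t ^ M"
        using Suc.prems(2) Suc by (simp add: mult_ac)
      also have "\<dots> = Suc t * Suc t ^ M'"
        by (simp add: Suc)
      finally have "card (shattered S (Suc t) n (link c V)) * t ^ M' < Suc t ^ M'"
        by (simp only: mult.assoc mult_less_cancel1)
      from Suc.IH[OF link_words[OF Suc.prems(1)] this] show ?thesis
        by (simp add: Q_def x_def C_def)
    qed
    have sumR: "(\<Sum>c\<in>T. b ^ of_bool (c \<in> R)) \<le> Q"
    proof -
      have "(\<Sum>c\<in>T. b ^ of_bool (c \<in> R)) = (\<Sum>c\<in>T. 1 + (b - 1) * of_bool (c \<in> R))"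
        by (intro sum.cong) auto
      also have "\<dots> = real s + (b - 1) * real (card (T \<inter> R))"
        using T by (simp add: sum.distrib flip: sum_distrib_left)
      also have "card (T \<inter> R) \<le> t"
        using cardR finR card_mono[of R "T \<inter> R"] by auto
      then have "real s + (b - 1) * real (card (T \<inter> R)) \<le> Q"
        using b by (simp add: Q_def mult.commute[of "b - 1"] mult_right_mono)
      finally show ?thesis .
    qed
    have "(\<Sum>a\<in>words T (Suc n). best b V a)
        \<le> (\<Sum>c\<in>T. \<Sum>a\<in>words T n. b ^ of_bool (c \<in> R) * best b (shadow V) a
             + (\<Sum>d\<in>S - R. b * best b (link d V) a))"
      unfolding sum_words_Suc
      by (intro sum_mono best_Cons[OF b S(1) Suc.prems(1)])
    also have "\<dots> = (\<Sum>c\<in>T. b ^ of_bool (c \<in> R)) * (\<Sum>a\<in>words T n. best b (shadow V) a)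
        + real s * (\<Sum>a\<in>words T n. \<Sum>d\<in>S - R. b * best b (link d V) a)"
      using T by (simp add: sum.distrib sum_product)
    also have "(\<Sum>a\<in>words T n. \<Sum>d\<in>S - R. b * best b (link d V) a)
        = b * (\<Sum>d\<in>S - R. \<Sum>a\<in>words T n. best b (link d V) a)"
      by (subst sum.swap) (simp only: sum_distrib_left)
    also have "real s * (b * (\<Sum>d\<in>S - R. \<Sum>a\<in>words T n. best b (link d V) a))
        = real s * b * (\<Sum>d\<in>S - R. \<Sum>a\<in>words T n. best b (link d V) a)"
      by simp
    also have "(\<Sum>c\<in>T. b ^ of_bool (c \<in> R)) * (\<Sum>a\<in>words T n. best b (shadow V) a)
        + real s * b * (\<Sum>d\<in>S - R. \<Sum>a\<in>words T n. best b (link d V) a)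
        \<le> Q * (Q ^ n * x ^ M) + real s * b * (\<Sum>d\<in>S - R. Q ^ n * x ^ M')"
      using IH1 IH2 sumR b Q x finV
      by (intro add_mono mult_mono mult_left_mono sum_mono sum_nonneg best_nonneg)
        (auto intro: finite_subset[OF shadow_words[OF Suc.prems(1)]] finite_words S)
    also have "Q * (Q ^ n * x ^ M) + real s * b * (\<Sum>d\<in>S - R. Q ^ n * x ^ M')
        \<le> Q * (Q ^ n * x ^ M) + real s * b * (real s * (Q ^ n * x ^ M'))"
    proof -
      have "card (S - R) \<le> s"
        using S card_mono[of S "S - R"] by auto
      then have "(\<Sum>d\<in>S - R. Q ^ n * x ^ M') \<le> real s * (Q ^ n * x ^ M')"
        using Q x by (simp add: mult_right_mono)
      then show ?thesis
        using b by (intro add_left_mono mult_left_mono) auto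
    qed
    also have "Q * (Q ^ n * x ^ M) + real s * b * (real s * (Q ^ n * x ^ M'))
        = Q ^ Suc n * x ^ M + Q ^ n * (C * x ^ M')"
      by (simp add: C_def power2_eq_square algebra_simps)
    also have "\<dots> \<le> Q ^ Suc n * x ^ M + Q ^ Suc n * (C * x ^ M')"
      using Q C x by (intro add_left_mono mult_right_mono power_increasing) auto
    also have "\<dots> = Q ^ Suc n * (x ^ Suc M' + C * x ^ M')"
      by (simp add: Suc algebra_simps)
    also have "\<dots> \<le> Q ^ Suc n * (x + C) ^ Suc M'"
      using Q C x by (intro mult_left_mono power_Suc_le_power_add) auto
    also have "x + C = C * real (Suc n) + 1"
      by (simp add: x_def algebra_simps)
    finally show ?thesis
      by (simp only: Suc Q_def C_def)
  qed
qed

section \<open>Columns of pattern-free matrices\<close>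

text \<open>Induction on the length: the letter \<open>z\<close> leaves \<open>D\<close> unchanged,
  and each of the \<open>card B\<close> other letters lowers it by one. With \<open>z = None\<close>
  this counts tests that have few demanding coordinates.\<close>

lemma card_words_few:
  fixes z :: 'a
  assumes B: "finite B" "z \<notin> B"
  shows "card {w \<in> words (insert z B) n. length (filter ((\<noteq>) z) w) \<le> D} \<le> (card B * n + 1) ^ D"
proof (induction n arbitrary: D)
  case 0
  have "card {w \<in> words (insert z B) 0. length (filter ((\<noteq>) z) w) \<le> D} \<le> card {[] :: 'a list}"
    by (intro card_mono) (auto simp: words_0)
  then show ?case by simp
next
  case (Suc n)
  let ?W = "\<lambda>n D. {w \<in> words (insert z B) n. length (filter ((\<noteq>) z) w) \<le> D}"
  have fin: "finite (?W n D)" for n D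
    using B finite_words[of "insert z B" n] by auto
  show ?case
  proof (cases D)
    case 0
    have "?W (Suc n) D \<subseteq> (#) z ` ?W n D"
      by (auto simp: words_Suc 0 split: if_splits)
    then have "card (?W (Suc n) D) \<le> card ((#) z ` ?W n D)"
      using fin by (intro card_mono) auto
    also have "\<dots> \<le> card (?W n D)"
      by (rule card_image_le[OF fin])
    finally show ?thesis using Suc.IH[of D] by (simp add: 0)
  next
    case (Suc D')
    have "?W (Suc n) D \<subseteq> (#) z ` ?W n D \<union> (\<Union>x\<in>B. (#) x ` ?W n D')"
      using B by (auto simp: words_Suc Suc split: if_splits)
    then have "card (?W (Suc n) D) \<le> card ((#) z ` ?W n D \<union> (\<Union>x\<in>B. (#) x ` ?W n D'))"
      using fin B by (intro card_mono) auto
    also have "\<dots> \<le> card ((#) z ` ?W n D) + card (\<Union>x\<in>B. (#) x ` ?W n D')"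
      by (rule card_Un_le)
    also have "\<dots> \<le> card ((#) z ` ?W n D) + (\<Sum>x\<in>B. card ((#) x ` ?W n D'))"
      using B by (intro add_left_mono card_UN_le)
    also have "\<dots> \<le> (card B * n + 1) ^ D + (\<Sum>x\<in>B. (card B * n + 1) ^ D')"
      by (intro add_mono sum_mono order_trans[OF card_image_le[OF fin] Suc.IH])
    also have "\<dots> \<le> (card B * n + 1 + card B) ^ D"
      using power_Suc_le_power_add[of "card B * n + 1" "card B" D'] by (simp add: Suc)
    finally show ?thesis by (simp add: add_ac)
  qed
qed

lemma card_subsets_of_card_le:
  assumes "finite S" "card S \<le> s"
  shows "finite {R. R \<subseteq> S \<and> card R = r}" "card {R. R \<subseteq> S \<and> card R = r} \<le> 2 ^ s"
proof -
  show "finite {R. R \<subseteq> S \<and> card R = r}"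
    using assms by simp
  have "card {R. R \<subseteq> S \<and> card R = r} \<le> card (Pow S)"
    using assms by (intro card_mono) auto
  also have "\<dots> = 2 ^ card S"
    using assms by (simp add: card_Pow)
  also have "\<dots> \<le> 2 ^ s"
    using assms by simp
  finally show "card {R. R \<subseteq> S \<and> card R = r} \<le> 2 ^ s" .
qed

text \<open>Pigeonhole: there are at most \<open>2 ^ s\<close> candidates for \<open>R\<close>, and
  if each occurred fewer than \<open>K\<close> times, at most \<open>2 ^ s * K\<close> coordinates
  would be demanding.\<close>

lemma repeated_subset_in_test:
  assumes S: "finite S" "card S \<le> s" and \<tau>: "\<tau> \<in> tests S r n"
    and many: "2 ^ s * K < length (filter ((\<noteq>) None) \<tau>)"
  shows "\<exists>R. R \<subseteq> S \<and> card R = r \<and> K \<le> card {i. i < n \<and> \<tau> ! i = Some R}"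
proof (rule ccontr)
  assume neg: "\<nexists>R. R \<subseteq> S \<and> card R = r \<and> K \<le> card {i. i < n \<and> \<tau> ! i = Some R}"
  let ?\<R> = "{R. R \<subseteq> S \<and> card R = r}"
  have len: "length \<tau> = n" and elem: "\<And>i. i < n \<Longrightarrow> \<tau> ! i \<in> insert None (Some ` ?\<R>)"
    using \<tau> by (auto simp: tests_def words_def dest!: nth_mem)
  have "length (filter ((\<noteq>) None) \<tau>) = card {i. i < n \<and> None \<noteq> \<tau> ! i}"
    by (simp add: length_filter_conv_card len)
  also have "\<dots> \<le> card (\<Union>R\<in>?\<R>. {i. i < n \<and> \<tau> ! i = Some R})"
    using elem S by (intro card_mono) fastforce+
  also have "\<dots> \<le> (\<Sum>R\<in>?\<R>. card {i. i < n \<and> \<tau> ! i = Some R})"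
    using card_subsets_of_card_le[OF S] by (intro card_UN_le)
  also have "\<dots> \<le> (\<Sum>R\<in>?\<R>. K)"
    using neg by (intro sum_mono) force
  also have "\<dots> \<le> 2 ^ s * K"
    using card_subsets_of_card_le[OF S] by simp
  finally show False
    using many by simp
qed

definition column_word :: "'a mat \<Rightarrow> nat \<Rightarrow> 'a list" where
  "column_word F j = map (\<lambda>i. F $$ (i, j)) [0..<dim_row F]"

definition column_words :: "'a mat \<Rightarrow> 'a list set" where
  "column_words F = column_word F ` {..<dim_col F}"

lemma column_word_simps:
  "length (column_word F j) = dim_row F"
  "i < dim_row F \<Longrightarrow> column_word F j ! i = F $$ (i, j)"
  by (simp_all add: column_word_def)

lemma column_words_subset: "column_words F \<subseteq> words (elements_mat F) (dim_row F)"
proof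
  fix w assume "w \<in> column_words F"
  then obtain j where j: "j < dim_col F" "w = column_word F j"
    by (auto simp: column_words_def)
  have "F $$ (i, j) \<in> elements_mat F" if "i < dim_row F" for i
    using elements_matI[OF carrier_matI[OF refl refl] that j(1) refl] .
  then show "w \<in> words (elements_mat F) (dim_row F)"
    by (auto simp: j(2) words_def column_word_def)
qed

text \<open>The last \<open>l\<close> of the \<open>k + l\<close> rows carry an identity matrix in two symbols, which forces
  the selected columns to be distinct even where the pattern has equal columns.\<close>

lemma has_subpattern_of_shatters:
  assumes P: "is_pattern k l r P" and r: "2 \<le> r"
    and sh: "shatters (column_words F) \<tau>" "\<tau> \<in> tests S r (dim_row F)"
    and R: "card R = r" "k + l \<le> card {i. i < dim_row F \<and> \<tau> ! i = Some R}"
  shows "has_subpattern k l P F"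
proof -
  let ?I = "{i. i < dim_row F \<and> \<tau> ! i = Some R}"
  have part: "partition_on ({..<k} \<times> {..<l}) P" and "card P = r"
    using P by (auto simp: is_pattern_def)
  then have "finite P" "finite R" "card P = card R"
    using r R(1) card.infinite by force+
  \<comment> \<open>Different classes receive different symbols of \<open>R\<close>, so the entries
    \<open>c p\<close> below realise the pattern.\<close>
  then obtain \<phi> where \<phi>: "bij_betw \<phi> P R"
    using finite_same_card_bij by blast
  obtain x y where xy: "x \<in> R" "y \<in> R" "x \<noteq> y"
    using R(1) r by (metis card_2_iff' card_le_Suc0_iff_eq \<open>finite R\<close> not_less_eq_eq numeral_2_eq_2)
  obtain \<kappa> where \<kappa>: "\<kappa> ` {..<k + l} \<subseteq> ?I" "inj_on \<kappa> {..<k + l}"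
    using card_le_inj[of "{..<k + l}" ?I] R(2) by auto
  have "\<forall>p\<in>{..<k} \<times> {..<l}. \<exists>T\<in>P. p \<in> T"
    using part by (auto simp: partition_on_def)
  then obtain cls where cls: "\<And>p. p \<in> {..<k} \<times> {..<l} \<Longrightarrow> cls p \<in> P \<and> p \<in> cls p"
    by metis
  have cls_eq: "T = cls p" if "T \<in> P" "p \<in> T" "p \<in> {..<k} \<times> {..<l}" for T p
    using part that cls[OF that(3)] unfolding partition_on_def disjoint_def by blast
  define c where "c p = \<phi> (cls p)" for p
  have c_in: "c p \<in> R" if "p \<in> {..<k} \<times> {..<l}" for p
    using \<phi> cls[OF that] by (auto simp: c_def bij_betw_def)
  have c_eq: "c p = c q \<longleftrightarrow> (\<exists>T\<in>P. p \<in> T \<and> q \<in> T)"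
    if "p \<in> {..<k} \<times> {..<l}" "q \<in> {..<k} \<times> {..<l}" for p q
  proof -
    have "c p = c q \<longleftrightarrow> cls p = cls q"
      using bij_betw_imp_inj_on[OF \<phi>] cls that by (metis c_def inj_onD)
    also have "\<dots> \<longleftrightarrow> (\<exists>T\<in>P. p \<in> T \<and> q \<in> T)"
      using cls cls_eq that by metis
    finally show ?thesis .
  qed
  define g where "g j u = (if u < k then c (u, j) else if u = k + j then x else y)" for j u
  have "\<exists>v\<in>column_words F. \<forall>u<k + l. v ! \<kappa> u = g j u" if "j < l" for j
  proof -
    \<comment> \<open>\<open>h\<close> extends the wishes for the selected rows to all coordinates:
      elsewhere it takes any symbol that the test demands, and one exists because the demanded sets
      have \<open>r \<ge> 2\<close> elements. At free coordinates its value is never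
      consulted.\<close>
    define h where "h i = (if i \<in> \<kappa> ` {..<k + l} then g j (the_inv_into {..<k + l} \<kappa> i)
      else (SOME z. z \<in> the (\<tau> ! i)))" for i
    have "h i \<in> R'" if i: "i < length \<tau>" "\<tau> ! i = Some R'" for i R'
    proof (cases "i \<in> \<kappa> ` {..<k + l}")
      case True
      then obtain u where u: "i = \<kappa> u" "u < k + l" by auto
      then have "R' = R"
        using \<kappa>(1) i(2) by auto
      then show ?thesis
        using u \<open>j < l\<close> xy c_in \<kappa>(2) by (auto simp: h_def g_def the_inv_into_f_f)
    next
      case False
      have "card R' = r"
        using sh(2) nth_mem[OF i(1)] i(2) by (auto simp: tests_def words_def)
      then have "R' \<noteq> {}"
        using r by auto
      then show ?thesis
        using False i(2) by (auto simp: h_def some_in_eq)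
    qed
    from shatters_choice[OF sh(1), of h, OF this] obtain v where v: "v \<in> column_words F"
      "\<forall>i<length \<tau>. \<tau> ! i \<noteq> None \<longrightarrow> v ! i = h i" by blast
    have "v ! \<kappa> u = g j u" if u: "u < k + l" for u
    proof -
      have "\<kappa> u \<in> ?I"
        using \<kappa>(1) u by auto
      then have "v ! \<kappa> u = h (\<kappa> u)"
        using v(2) sh(2) by (auto simp: tests_def words_def)
      then show ?thesis
        using \<kappa>(2) u by (auto simp: h_def the_inv_into_f_f)
    qed
    with v(1) show ?thesis by blast
  qed
  then have "\<exists>q<dim_col F. \<forall>u<k + l. F $$ (\<kappa> u, q) = g j u" if "j < l" for j
    using that \<kappa>(1) unfolding column_words_def
    by (fastforce simp: column_word_simps image_subset_iff)
  then obtain \<gamma> where \<gamma>: "\<And>j. j < l \<Longrightarrow> \<gamma> j < dim_col F"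
    "\<And>j u. j < l \<Longrightarrow> u < k + l \<Longrightarrow> F $$ (\<kappa> u, \<gamma> j) = g j u"
    by metis
  have "inj_on \<gamma> {..<l}"
  proof (rule inj_onI)
    fix j j' assume j: "j \<in> {..<l}" "j' \<in> {..<l}" "\<gamma> j = \<gamma> j'"
    \<comment> \<open>In the selected row \<open>k + j\<close>, column \<open>j\<close> carries
      \<open>x\<close> and all other selected columns carry \<open>y\<close>.\<close>
    then have "g j (k + j) = g j' (k + j)"
      using \<gamma>(2)[of j "k + j"] \<gamma>(2)[of j' "k + j"] by simp
    then show "j = j'"
      using xy by (auto simp: g_def split: if_splits)
  qed
  moreover have "inj_on \<kappa> {..<k}" "\<kappa> ` {..<k} \<subseteq> {..<dim_row F}"
    using \<kappa> by (auto intro: inj_on_subset simp: image_subset_iff)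
  ultimately have "is_submatrix (mat k l c) F"
    unfolding is_submatrix_def using \<gamma>
    by (intro exI[of _ \<kappa>] exI[of _ \<gamma>]) (auto simp: g_def)
  moreover have "has_pattern k l P (mat k l c)"
    using c_eq by (auto simp: has_pattern_def)
  ultimately show ?thesis
    by (auto simp: has_subpattern_def)
qed

section \<open>Agreement with the matrix of all words\<close>

lemma mat_dist_eq_sum_agree:
  assumes "A \<in> carrier_mat n N" "F \<in> carrier_mat n N"
  shows "mat_dist A F + (\<Sum>j<N. agree (column_word A j) (column_word F j)) = n * N"
proof -
  let ?P = "\<lambda>(i, j). A $$ (i, j) = F $$ (i, j)"
  have "(\<Sum>j<N. agree (column_word A j) (column_word F j))
      = (\<Sum>j<N. card {i. i < n \<and> A $$ (i, j) = F $$ (i, j)})"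
    using assms
    by (intro sum.cong refl, subst agree_eq_card[of _ n])
      (auto simp: column_word_simps intro!: arg_cong[of _ _ card])
  also have "\<dots> = card (SIGMA j:{..<N}. {i. i < n \<and> A $$ (i, j) = F $$ (i, j)})"
    by simp
  also have "\<dots> = card (prod.swap ` (SIGMA j:{..<N}. {i. i < n \<and> A $$ (i, j) = F $$ (i, j)}))"
    by (simp add: card_image)
  also have "prod.swap ` (SIGMA j:{..<N}. {i. i < n \<and> A $$ (i, j) = F $$ (i, j)})
      = {p \<in> {..<n} \<times> {..<N}. ?P p}"
    by force
  finally have *: "(\<Sum>j<N. agree (column_word A j) (column_word F j))
      = card {p \<in> {..<n} \<times> {..<N}. ?P p}" .
  have "mat_dist A F = card {p \<in> {..<n} \<times> {..<N}. \<not> ?P p}"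
    using assms unfolding mat_dist_def by (intro arg_cong[of _ _ card]) auto
  moreover have "card {p \<in> {..<n} \<times> {..<N}. \<not> ?P p} + card {p \<in> {..<n} \<times> {..<N}. ?P p}
      = card ({p \<in> {..<n} \<times> {..<N}. \<not> ?P p} \<union> {p \<in> {..<n} \<times> {..<N}. ?P p})"
    by (subst card_Un_disjoint) auto
  moreover have "{p \<in> {..<n} \<times> {..<N}. \<not> ?P p} \<union> {p \<in> {..<n} \<times> {..<N}. ?P p} = {..<n} \<times> {..<N}"
    by blast
  ultimately show ?thesis
    using * by simp
qed

text \<open>Meant for a bijection \<open>e\<close> onto \<open>words T n\<close>: then every word is a column exactly once.\<close>

definition all_words_mat :: "'a set \<Rightarrow> nat \<Rightarrow> (nat \<Rightarrow> 'a list) \<Rightarrow> 'a mat" where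
  "all_words_mat T n e = mat n (card T ^ n) (\<lambda>(i, j). e j ! i)"

text \<open>A symbol of \<open>T\<close> occurs because its constant word is one of the columns, and
  for \<open>0 < n\<close> that column has an entry.\<close>

lemma elements_all_words_mat:
  assumes "bij_betw e {..<card T ^ n} (words T n)" "0 < n"
  shows "elements_mat (all_words_mat T n e) = T"
proof -
  have carr: "all_words_mat T n e \<in> carrier_mat n (card T ^ n)"
    by (simp add: all_words_mat_def)
  show ?thesis
  proof (intro equalityI subsetI)
    fix x assume "x \<in> elements_mat (all_words_mat T n e)"
    then obtain i j where ij: "i < n" "j < card T ^ n" "x = e j ! i"
      using carr by (auto simp: all_words_mat_def dest!: elements_matD)
    then have "e j \<in> words T n"
      using assms(1) by (auto simp: bij_betw_def)
    then show "x \<in> T"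
      using ij by (auto simp: words_def)
  next
    fix x assume "x \<in> T"
    then have "replicate n x \<in> words T n"
      by (auto simp: words_def)
    then have "replicate n x \<in> e ` {..<card T ^ n}"
      using assms(1) by (simp add: bij_betw_def)
    then obtain j where j: "j < card T ^ n" "e j = replicate n x"
      by (metis imageE lessThan_iff)
    show "x \<in> elements_mat (all_words_mat T n e)"
      by (rule elements_matI[OF carr assms(2) j(1)])
        (use j assms(2) in \<open>simp add: all_words_mat_def\<close>)
  qed
qed

text \<open>A shattered test with more than \<open>2 ^ s * (k + l)\<close> demanding coordinates
  would demand one set at \<open>k + l\<close> of them and so produce the subpattern. Hence the
  shattered tests are sparse words over at most \<open>2 ^ s\<close> demands, and for fixed
  \<open>s\<close>, \<open>k\<close> and \<open>l\<close> their number is polynomial in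
  \<open>n\<close>.\<close>

lemma card_shattered_column_words_le:
  assumes P: "is_pattern k l r P" "2 \<le> r" and F: "F \<in> Forb n N s k l P"
  shows "card (shattered (elements_mat F) r n (column_words F)) \<le> (2 ^ s * n + 1) ^ (2 ^ s * (k + l))"
proof -
  let ?S = "elements_mat F" and ?D = "2 ^ s * (k + l)"
  let ?B = "Some ` {R. R \<subseteq> ?S \<and> card R = r}"
  have carr: "F \<in> carrier_mat n N" and S: "finite ?S" "card ?S \<le> s"
    and no: "\<not> has_subpattern k l P F"
    using F by (auto simp: Forb_def elements_mat_def)
  have dim: "dim_row F = n" using carr by auto
  have B: "finite ?B" "None \<notin> ?B" "card ?B \<le> 2 ^ s"
    using card_subsets_of_card_le[OF S, of r] by (auto simp: card_image)
  have "shattered ?S r n (column_words F)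
      \<subseteq> {\<tau> \<in> words (insert None ?B) n. length (filter ((\<noteq>) None) \<tau>) \<le> ?D}"
  proof
    fix \<tau> assume \<tau>: "\<tau> \<in> shattered ?S r n (column_words F)"
    have "length (filter ((\<noteq>) None) \<tau>) \<le> ?D"
    proof (rule ccontr)
      assume "\<not> length (filter ((\<noteq>) None) \<tau>) \<le> ?D"
      then obtain R where "card R = r" "k + l \<le> card {i. i < n \<and> \<tau> ! i = Some R}"
        using repeated_subset_in_test[OF S, of \<tau> r n "k + l"] \<tau> by (auto simp: shattered_def)
      moreover have "shatters (column_words F) \<tau>" "\<tau> \<in> tests ?S r (dim_row F)"
        using \<tau> by (auto simp: shattered_def dim)
      ultimately have "has_subpattern k l P F"
        using has_subpattern_of_shatters[OF P, of F \<tau> ?S R] by (simp add: dim)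
      with no show False ..
    qed
    with \<tau> show "\<tau> \<in> {\<tau> \<in> words (insert None ?B) n. length (filter ((\<noteq>) None) \<tau>) \<le> ?D}"
      by (auto simp: shattered_def tests_def)
  qed
  then have "card (shattered ?S r n (column_words F))
      \<le> card {\<tau> \<in> words (insert None ?B) n. length (filter ((\<noteq>) None) \<tau>) \<le> ?D}"
    by (rule card_mono[rotated]) (rule finite_subset[OF _ finite_words[of "insert None ?B" n]], use B in auto)
  also have "\<dots> \<le> (card ?B * n + 1) ^ ?D"
    by (rule card_words_few[OF B(1,2)])
  also have "\<dots> \<le> (2 ^ s * n + 1) ^ ?D"
    using B(3) by (intro power_mono add_right_mono mult_right_mono) auto
  finally show ?thesis .
qed

text \<open>Jensen's inequality for the logarithm, in the form of the tangent bound
  \<open>ln u \<le> u - 1\<close> at \<open>u = b ^ agree a (f a) / B\<close>. The choice of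
  \<open>f\<close> is free because \<open>best\<close> dominates every column of
  \<open>F\<close>.\<close>

lemma sum_agree_le:
  fixes T :: "'a set" and b :: real
  assumes P: "is_pattern k l (Suc t) P" "1 \<le> t" and F: "F \<in> Forb n N s k l P"
    and T: "finite T" "card T = s" "0 < s" and b: "1 < b"
    and M: "(2 ^ s * n + 1) ^ (2 ^ s * (k + l)) * t ^ M < Suc t ^ M"
    and f: "\<And>a. a \<in> words T n \<Longrightarrow> f a \<in> column_words F"
  shows "(\<Sum>a\<in>words T n. real (agree a (f a))) * ln b
    \<le> real s ^ n * (real n * (real t / real s * (b - 1)) + real M * ln (real s ^ 2 * b * real n + 1))"
proof -
  let ?S = "elements_mat F" and ?V = "column_words F"
  have carr: "F \<in> carrier_mat n N" and S: "finite ?S" "card ?S \<le> s"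
    using F by (auto simp: Forb_def elements_mat_def)
  have V: "?V \<subseteq> words ?S n" and finV: "finite ?V"
    using column_words_subset[of F] carr by (auto simp: column_words_def)
  define Q where "Q = real s + real t * (b - 1)"
  define y where "y = real s ^ 2 * b * real n + 1"
  \<comment> \<open>\<open>s ^ n * B\<close> is the bound of \<open>sum_best_le\<close>, so
    \<open>B\<close> bounds the mean of \<open>best\<close> over all words, and the terms
    \<open>best b ?V a / B - 1\<close> add up to at most 0.\<close>
  define B where "B = (Q / real s) ^ n * y ^ M"
  have pos: "0 < Q" "0 < y"
    using T b by (simp_all add: Q_def y_def add_pos_nonneg add_nonneg_pos)
  then have pos': "0 < Q / real s" "0 < B"
    using T by (auto simp: B_def)
  have "card (shattered ?S (Suc t) n ?V) * t ^ M \<le> (2 ^ s * n + 1) ^ (2 ^ s * (k + l)) * t ^ M"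
    using card_shattered_column_words_le[OF P(1) _ F] P(2) by (intro mult_right_mono) auto
  then have "card (shattered ?S (Suc t) n ?V) * t ^ M < Suc t ^ M"
    using M by (rule order.strict_trans1)
  then have best: "(\<Sum>a\<in>words T n. best b ?V a) \<le> Q ^ n * y ^ M"
    using sum_best_le[of b T s ?S t ?V n M] b T S P(2) V by (auto simp: Q_def y_def)
  have "(\<Sum>a\<in>words T n. real (agree a (f a))) * ln b \<le> (\<Sum>a\<in>words T n. ln B + best b ?V a / B - 1)"
    unfolding sum_distrib_right
  proof (rule sum_mono)
    fix a assume "a \<in> words T n"
    have "ln (b ^ agree a (f a) / B) \<le> b ^ agree a (f a) / B - 1"
      using b pos pos' by (intro ln_le_minus_one) auto
    moreover have "ln (b ^ agree a (f a) / B) = real (agree a (f a)) * ln b - ln B"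
      using b pos pos' by (simp add: ln_div ln_realpow)
    moreover have "b ^ agree a (f a) / B \<le> best b ?V a / B"
      using pos' best_ge[OF finV f[OF \<open>a \<in> words T n\<close>]] by (simp add: divide_right_mono)
    ultimately show "real (agree a (f a)) * ln b \<le> ln B + best b ?V a / B - 1"
      by simp
  qed
  also have "\<dots> = real s ^ n * (ln B - 1) + (\<Sum>a\<in>words T n. best b ?V a) / B"
    using T by (simp add: sum.distrib sum_subtractf card_words sum_divide_distrib algebra_simps)
  also have "\<dots> \<le> real s ^ n * (ln B - 1) + (Q ^ n * y ^ M) / B"
    using best pos pos' by (intro add_left_mono divide_right_mono) auto
  also have "(Q ^ n * y ^ M) / B = real s ^ n"
    using pos pos' T by (simp add: B_def power_divide)
  also have "real s ^ n * (ln B - 1) + real s ^ n = real s ^ n * ln B"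
    by (simp add: algebra_simps)
  also have "ln B = real n * ln (Q / real s) + real M * ln y"
    using pos pos' T by (simp add: B_def ln_mult ln_realpow)
  \<comment> \<open>Little is lost here for \<open>b\<close> near 1, the range in which
    \<open>b\<close> will be chosen.\<close>
  also have "ln (Q / real s) \<le> Q / real s - 1"
    using pos pos' by (intro ln_le_minus_one)
  also have "Q / real s - 1 = real t / real s * (b - 1)"
    using T by (simp add: Q_def field_simps)
  finally show ?thesis
    by (simp add: y_def mult_left_mono)
qed

section \<open>A block far from the pattern-free matrices\<close>

text \<open>Two limits, one after the other: \<open>b\<close> near 1 brings
  \<open>(b - 1) / ln b\<close> near 1, and then \<open>M\<close> grows, with blocks of height
  \<open>n = M ^ 2\<close>. This size suits both demands on \<open>M\<close>: the factor
  \<open>(t / (t + 1)) ^ M\<close> beats every fixed power of \<open>n\<close>, while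
  \<open>M * ln n\<close> is still \<open>o(n)\<close>.\<close>

lemma exists_block_parameters:
  fixes c \<epsilon> :: real and s t D :: nat
  assumes "0 < c" "0 < s" "1 \<le> t" "0 < \<epsilon>"
  shows "\<exists>b>1. \<exists>M>0. (c * real (M ^ 2) + 1) ^ D * real t ^ M < real (Suc t) ^ M \<and>
    real (M ^ 2) * (real t / real s * (b - 1)) + real M * ln (real s ^ 2 * b * real (M ^ 2) + 1)
      \<le> (real t / real s + \<epsilon>) * real (M ^ 2) * ln b"
proof -
  define \<alpha> where "\<alpha> = real t / real s"
  have "((\<lambda>b::real. (b - 1) / ln b) \<longlongrightarrow> 1) (at_right 1)"
    by real_asymp
  then have "((\<lambda>b::real. \<alpha> * ((b - 1) / ln b)) \<longlongrightarrow> \<alpha> * 1) (at_right 1)"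
    by (intro tendsto_intros)
  then have "eventually (\<lambda>b::real. \<alpha> * ((b - 1) / ln b) < \<alpha> + \<epsilon> / 2) (at_right 1)"
    by (rule order_tendstoD) (use assms in simp)
  moreover have "eventually (\<lambda>b::real. 1 < b) (at_right 1)"
    by (simp add: eventually_at_right_less)
  ultimately have "eventually (\<lambda>b::real. 1 < b \<and> \<alpha> * ((b - 1) / ln b) < \<alpha> + \<epsilon> / 2) (at_right 1)"
    by eventually_elim simp
  then obtain b :: real where b: "1 < b" "\<alpha> * ((b - 1) / ln b) < \<alpha> + \<epsilon> / 2"
    using eventually_happens'[OF trivial_limit_at_right_real] by blast
  define \<rho> where "\<rho> = real t / real (Suc t)"
  have \<rho>: "0 < \<rho>" "\<rho> < 1"
    using assms by (auto simp: \<rho>_def)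
  have "(\<lambda>M::nat. (c * real (M ^ 2) + 1) ^ D * \<rho> ^ M) \<longlonglongrightarrow> 0"
    using assms \<rho> by real_asymp
  then have ev1: "eventually (\<lambda>M. (c * real (M ^ 2) + 1) ^ D * \<rho> ^ M < 1) sequentially"
    by (rule order_tendstoD) simp
  define d where "d = real s ^ 2 * b"
  have "0 < d"
    using assms b by (simp add: d_def)
  then have "(\<lambda>M::nat. real M * ln (d * real (M ^ 2) + 1) / real (M ^ 2)) \<longlonglongrightarrow> 0"
    by real_asymp
  then have ev2: "eventually (\<lambda>M. real M * ln (d * real (M ^ 2) + 1) / real (M ^ 2) < \<epsilon> / 2 * ln b)
      sequentially"
    by (rule order_tendstoD) (use assms b in simp)
  obtain M :: nat where M: "0 < M" "(c * real (M ^ 2) + 1) ^ D * \<rho> ^ M < 1"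
    "real M * ln (d * real (M ^ 2) + 1) / real (M ^ 2) < \<epsilon> / 2 * ln b"
    using eventually_happens'[OF _ eventually_conj[OF eventually_gt_at_top[of 0] eventually_conj[OF ev1 ev2]]]
    by auto
  have "(c * real (M ^ 2) + 1) ^ D * real t ^ M = (c * real (M ^ 2) + 1) ^ D * \<rho> ^ M * real (Suc t) ^ M"
    by (simp add: \<rho>_def power_divide del: of_nat_Suc)
  also have "\<dots> < 1 * real (Suc t) ^ M"
    using M(2) by (intro mult_strict_right_mono) auto
  finally have 1: "(c * real (M ^ 2) + 1) ^ D * real t ^ M < real (Suc t) ^ M"
    by simp
  have "\<alpha> * (b - 1) \<le> (\<alpha> + \<epsilon> / 2) * ln b"
    using b by (simp add: field_simps)
  then have "real (M ^ 2) * (\<alpha> * (b - 1)) \<le> real (M ^ 2) * ((\<alpha> + \<epsilon> / 2) * ln b)"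
    by (rule mult_left_mono) simp
  moreover have "real M * ln (d * real (M ^ 2) + 1) \<le> real (M ^ 2) * (\<epsilon> / 2 * ln b)"
    using M(1,3) by (simp add: divide_less_eq mult.commute del: of_nat_power)
  ultimately have "real (M ^ 2) * (\<alpha> * (b - 1)) + real M * ln (d * real (M ^ 2) + 1)
      \<le> real (M ^ 2) * ((\<alpha> + \<epsilon> / 2) * ln b) + real (M ^ 2) * (\<epsilon> / 2 * ln b)"
    by (rule add_mono)
  also have "\<dots> = (\<alpha> + \<epsilon>) * real (M ^ 2) * ln b"
    by (simp add: algebra_simps)
  finally show ?thesis
    using b(1) M(1) 1 unfolding \<alpha>_def d_def by blast
qed

text \<open>Since every word over \<open>T\<close> is a column of \<open>A\<close> exactly once, the
  agreements of \<open>A\<close> with \<open>F\<close> form a sum over all words, to which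
  \<open>sum_agree_le\<close> applies. The width \<open>s ^ n\<close> is exponential in the height,
  which is harmless for a block of fixed size.\<close>

lemma exists_block_far_from_Forb:
  fixes T :: "'a set" and \<epsilon> :: real
  assumes P: "is_pattern k l (Suc t) P" "1 \<le> t"
    and T: "finite T" "card T = s" "0 < s" and "0 < \<epsilon>"
  shows "\<exists>n N (A :: 'a mat). 0 < n \<and> 0 < N \<and> A \<in> carrier_mat n N \<and> card (elements_mat A) = s \<and>
    (\<forall>F\<in>Forb n N s k l P. (1 - real t / real s - \<epsilon>) * (real n * real N) \<le> real (mat_dist A F))"
proof -
  obtain b :: real and M :: nat where bM: "1 < b" "0 < M"
    "(2 ^ s * real (M ^ 2) + 1) ^ (2 ^ s * (k + l)) * real t ^ M < real (Suc t) ^ M"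
    "real (M ^ 2) * (real t / real s * (b - 1)) + real M * ln (real s ^ 2 * b * real (M ^ 2) + 1)
      \<le> (real t / real s + \<epsilon>) * real (M ^ 2) * ln b"
    using exists_block_parameters[of "2 ^ s" s t \<epsilon> "2 ^ s * (k + l)"] assms by auto
  define n where "n = M ^ 2"
  have "0 < n"
    using bM(2) by (simp add: n_def)
  have "real ((2 ^ s * n + 1) ^ (2 ^ s * (k + l)) * t ^ M) < real (Suc t ^ M)"
    using bM(3) by (simp add: n_def add.commute)
  then have M: "(2 ^ s * n + 1) ^ (2 ^ s * (k + l)) * t ^ M < Suc t ^ M"
    by (rule of_nat_less_imp_less)
  obtain e where e: "bij_betw e {..<s ^ n} (words T n)"
    using T finite_words[of T n] ex_bij_betw_nat_finite[of "words T n"]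
    by (auto simp: card_words atLeast0LessThan)
  define A where "A = all_words_mat T n e"
  have A: "A \<in> carrier_mat n (s ^ n)"
    by (simp add: A_def all_words_mat_def T)
  have col_A: "column_word A j = e j" if "j < s ^ n" for j
  proof -
    have "length (e j) = n"
      using e that by (auto simp: bij_betw_def words_def)
    then show ?thesis
      using that by (auto simp: column_word_def A_def all_words_mat_def T intro!: nth_equalityI)
  qed
  have "(1 - real t / real s - \<epsilon>) * (real n * real (s ^ n)) \<le> real (mat_dist A F)"
    if F: "F \<in> Forb n (s ^ n) s k l P" for F
  proof -
    have carr: "F \<in> carrier_mat n (s ^ n)"
      using F by (simp add: Forb_def)
    \<comment> \<open>\<open>f a\<close> is the column of \<open>F\<close> at the place where
      \<open>A\<close> has the column \<open>a\<close>.\<close>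
    define f where "f a = column_word F (the_inv_into {..<s ^ n} e a)" for a
    have f: "f a \<in> column_words F" if "a \<in> words T n" for a
      using bij_betw_the_inv_into[OF e] that carr
      by (auto simp: f_def column_words_def bij_betw_def)
    have "(\<Sum>j<s ^ n. agree (column_word A j) (column_word F j)) = (\<Sum>j<s ^ n. agree (e j) (f (e j)))"
      using e by (intro sum.cong) (auto simp: col_A f_def bij_betw_def the_inv_into_f_f)
    also have "\<dots> = (\<Sum>a\<in>words T n. agree a (f a))"
      using e by (rule sum.reindex_bij_betw)
    finally have dist: "real (mat_dist A F) + (\<Sum>a\<in>words T n. real (agree a (f a))) = real n * real s ^ n"
      using mat_dist_eq_sum_agree[OF A carr] by (simp flip: of_nat_sum of_nat_add of_nat_mult of_nat_power)
    have "(\<Sum>a\<in>words T n. real (agree a (f a))) * ln b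
        \<le> real s ^ n * (real n * (real t / real s * (b - 1)) + real M * ln (real s ^ 2 * b * real n + 1))"
      by (rule sum_agree_le[OF P F T bM(1) M]) (rule f)
    also have "\<dots> \<le> real s ^ n * ((real t / real s + \<epsilon>) * real n * ln b)"
      using bM(4) unfolding n_def by (rule mult_left_mono) simp
    finally have "(\<Sum>a\<in>words T n. real (agree a (f a))) * ln b
        \<le> real s ^ n * ((real t / real s + \<epsilon>) * real n * ln b)" .
    then have "(\<Sum>a\<in>words T n. real (agree a (f a))) * ln b
        \<le> (real s ^ n * ((real t / real s + \<epsilon>) * real n)) * ln b"
      by (simp only: mult.assoc)
    then have "(\<Sum>a\<in>words T n. real (agree a (f a))) \<le> real s ^ n * ((real t / real s + \<epsilon>) * real n)"
      by (rule mult_right_le_imp_le) (use bM(1) in simp)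
    with dist show ?thesis
      by (simp add: algebra_simps)
  qed
  moreover have "card (elements_mat A) = s"
    using elements_all_words_mat[of e T n] e \<open>0 < n\<close> T by (simp add: A_def)
  ultimately show ?thesis
    using A \<open>0 < n\<close> T by (intro exI[of _ n] exI[of _ "s ^ n"] exI[of _ A]) auto
qed

section \<open>Submatrices and periodic tilings\<close>

lemma is_submatrix_trans:
  assumes "is_submatrix C B" "is_submatrix B A"
  shows "is_submatrix C A"
proof -
  from assms(1) obtain \<rho> \<gamma> where 1:
    "inj_on \<rho> {..<dim_row C}" "\<rho> ` {..<dim_row C} \<subseteq> {..<dim_row B}"
    "inj_on \<gamma> {..<dim_col C}" "\<gamma> ` {..<dim_col C} \<subseteq> {..<dim_col B}"
    "\<forall>\<alpha> < dim_row C. \<forall>\<beta> < dim_col C. C $$ (\<alpha>, \<beta>) = B $$ (\<rho> \<alpha>, \<gamma> \<beta>)"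
    unfolding is_submatrix_def by blast
  from assms(2) obtain \<rho>' \<gamma>' where 2: "inj_on \<rho>' {..<dim_row B}" "\<rho>' ` {..<dim_row B} \<subseteq> {..<dim_row A}"
    "inj_on \<gamma>' {..<dim_col B}" "\<gamma>' ` {..<dim_col B} \<subseteq> {..<dim_col A}"
    "\<forall>\<alpha> < dim_row B. \<forall>\<beta> < dim_col B. B $$ (\<alpha>, \<beta>) = A $$ (\<rho>' \<alpha>, \<gamma>' \<beta>)"
    unfolding is_submatrix_def by blast
  have "inj_on (\<rho>' \<circ> \<rho>) {..<dim_row C}" "inj_on (\<gamma>' \<circ> \<gamma>) {..<dim_col C}"
    using comp_inj_on[OF 1(1) inj_on_subset[OF 2(1) 1(2)]] comp_inj_on[OF 1(3) inj_on_subset[OF 2(3) 1(4)]] .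
  then show ?thesis
    unfolding is_submatrix_def using 1 2
    by (intro exI[of _ "\<rho>' \<circ> \<rho>"] exI[of _ "\<gamma>' \<circ> \<gamma>"]) (auto simp: image_subset_iff)
qed

lemma elements_submatrix:
  assumes "is_submatrix B F"
  shows "elements_mat B \<subseteq> elements_mat F"
proof
  fix x assume "x \<in> elements_mat B"
  then obtain i j where ij: "i < dim_row B" "j < dim_col B" "x = B $$ (i, j)" by blast
  from assms obtain \<rho> \<gamma> where
    "\<rho> ` {..<dim_row B} \<subseteq> {..<dim_row F}" "\<gamma> ` {..<dim_col B} \<subseteq> {..<dim_col F}"
    "\<forall>\<alpha> < dim_row B. \<forall>\<beta> < dim_col B. B $$ (\<alpha>, \<beta>) = F $$ (\<rho> \<alpha>, \<gamma> \<beta>)"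
    unfolding is_submatrix_def by blast
  then show "x \<in> elements_mat F"
    using ij elements_matI[OF carrier_matI[OF refl refl], of "\<rho> i" F "\<gamma> j" x] by auto
qed

lemma submatrix_in_Forb:
  assumes F: "F \<in> Forb m n s k l P" and B: "B \<in> carrier_mat m' n'" "is_submatrix B F"
  shows "B \<in> Forb m' n' s k l P"
proof -
  have "card (elements_mat B) \<le> card (elements_mat F)"
    using elements_submatrix[OF B(2)] by (intro card_mono) (auto simp: elements_mat_def)
  then show ?thesis
    using F B is_submatrix_trans by (fastforce simp: Forb_def has_subpattern_def)
qed

definition tile :: "'a mat \<Rightarrow> nat \<Rightarrow> nat \<Rightarrow> 'a mat" where
  "tile A m n = mat m n (\<lambda>(i, j). A $$ (i mod dim_row A, j mod dim_col A))"

lemma elements_tile: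
  assumes "0 < dim_row A" "0 < dim_col A" "dim_row A \<le> m" "dim_col A \<le> n"
  shows "elements_mat (tile A m n) = elements_mat A"
proof (intro equalityI subsetI)
  fix x assume "x \<in> elements_mat (tile A m n)"
  then obtain i j where "i < m" "j < n" "x = A $$ (i mod dim_row A, j mod dim_col A)"
    by (auto simp: tile_def dest!: elements_matD)
  then show "x \<in> elements_mat A"
    using assms by (auto intro!: elements_matI[OF carrier_matI[OF refl refl], of "i mod dim_row A" A "j mod dim_col A"])
next
  fix x assume "x \<in> elements_mat A"
  then obtain i j where "i < dim_row A" "j < dim_col A" "x = A $$ (i, j)" by blast
  then show "x \<in> elements_mat (tile A m n)"
    using assms by (intro elements_matI[of "tile A m n" m n i j]) (auto simp: tile_def)
qed

text \<open>The complete blocks of the tiling are disjoint. The part of \<open>F\<close> below such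
  a block is a submatrix of \<open>F\<close>, so it avoids the pattern and has at most
  \<open>s\<close> symbols, and the block contributes at least \<open>d\<close> differences. The
  incomplete blocks at the margins are discarded.\<close>

lemma tile_dist_ge:
  fixes A :: "'a mat"
  assumes A: "A \<in> carrier_mat n N" "0 < n" "0 < N"
    and far: "\<And>F. F \<in> Forb n N s k l P \<Longrightarrow> d \<le> mat_dist A F"
    and F: "F \<in> Forb m m' s k l P"
  shows "(m div n) * (m' div N) * d \<le> mat_dist (tile A m m') F"
proof -
  let ?I = "{..<m div n} \<times> {..<m' div N}"
  have F': "F \<in> carrier_mat m m'"
    using F by (simp add: Forb_def)
  define blk where "blk = (\<lambda>(a, c). mat n N (\<lambda>(i, j). F $$ (a * n + i, c * N + j)))"
  define D where "D p = {(i, j). i < n \<and> j < N \<and> A $$ (i, j) \<noteq> blk p $$ (i, j)}" for p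
  define h where "h = (\<lambda>((a, c), (i, j)). (a * n + i, c * N + j))"
  have lt: "a * q + i < p" if "a < p div q" "i < q" for a i p q :: nat
  proof -
    have "a * q + i < Suc a * q"
      using that by simp
    also have "\<dots> \<le> p div q * q"
      using that by (intro mult_right_mono) auto
    also have "\<dots> \<le> p" by simp
    finally show ?thesis .
  qed
  have blk: "blk p \<in> Forb n N s k l P" if pI: "p \<in> ?I" for p
  proof (rule submatrix_in_Forb[OF F])
    obtain a c where p: "p = (a, c)" "a < m div n" "c < m' div N"
      using pI by auto
    show "blk p \<in> carrier_mat n N"
      by (simp add: blk_def p)
    show "is_submatrix (blk p) F"
      unfolding is_submatrix_def using F' p
      by (intro exI[of _ "\<lambda>i. a * n + i"] exI[of _ "\<lambda>j. c * N + j"])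
        (auto simp: blk_def inj_on_def intro!: lt)
  qed
  have finD: "finite (D p)" for p
    by (rule finite_subset[of _ "{..<n} \<times> {..<N}"]) (auto simp: D_def)
  have "(m div n) * (m' div N) * d = (\<Sum>p\<in>?I. d)"
    by simp
  also have "\<dots> \<le> (\<Sum>p\<in>?I. card (D p))"
  proof (rule sum_mono)
    fix p assume "p \<in> ?I"
    then show "d \<le> card (D p)"
      using far[OF blk] A by (simp add: mat_dist_def D_def)
  qed
  also have "\<dots> = card (Sigma ?I D)"
    using finD by (simp add: card_SigmaI)
  also have "\<dots> \<le> mat_dist (tile A m m') F"
    unfolding mat_dist_def
  proof (rule card_inj_on_le)
    show "inj_on h (Sigma ?I D)"
    proof (rule inj_onI)
      fix u v assume uv: "u \<in> Sigma ?I D" "v \<in> Sigma ?I D" "h u = h v"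
      obtain a c i j where u: "u = ((a, c), (i, j))" by (metis prod.exhaust)
      obtain a' c' i' j' where v: "v = ((a', c'), (i', j'))" by (metis prod.exhaust)
      have lt: "i < n" "j < N" "i' < n" "j' < N"
        using uv by (auto simp: u v D_def)
      have eq: "a * n + i = a' * n + i'" "c * N + j = c' * N + j'"
        using uv(3) by (auto simp: h_def u v)
      \<comment> \<open>Integer division by \<open>n\<close> and \<open>N\<close> recovers the block
        from a position.\<close>
      from arg_cong[OF eq(1), of "\<lambda>x. x div n"] arg_cong[OF eq(2), of "\<lambda>x. x div N"]
      have "a = a'" "c = c'"
        using lt by simp_all
      with eq show "u = v"
        by (simp add: u v)
    qed
    show "h ` Sigma ?I D \<subseteq> {(i, j). i < dim_row (tile A m m') \<and> j < dim_col (tile A m m') \<and>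
        tile A m m' $$ (i, j) \<noteq> F $$ (i, j)}"
      using A by (auto simp: h_def D_def blk_def tile_def lt)
    show "finite {(i, j). i < dim_row (tile A m m') \<and> j < dim_col (tile A m m') \<and>
        tile A m m' $$ (i, j) \<noteq> F $$ (i, j)}"
      by (rule finite_subset[of _ "{..<m} \<times> {..<m'}"]) (auto simp: tile_def)
  qed
  finally show ?thesis .
qed

section \<open>The upper bound and the limit\<close>

text \<open>Removing a lightest element does not lower the average weight, so this is repeated until
  \<open>t\<close> elements are left. Averages are written as products; the factor \<open>n\<close>
  is cancelled at the end, which sets the case \<open>n = 0\<close> apart.\<close>

lemma exists_heavy_subset:
  fixes w :: "'a \<Rightarrow> nat"
  assumes "finite E" "t \<le> card E"
  shows "\<exists>R\<subseteq>E. card R = t \<and> t * sum w E \<le> card E * sum w R"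
  using assms
proof (induction "card E" arbitrary: E)
  case 0
  then show ?case by auto
next
  case (Suc n)
  show ?case
  proof (cases "t = Suc n")
    case True
    then show ?thesis using Suc by auto
  next
    case False
    have "E \<noteq> {}"
      using Suc by auto
    define x where "x = arg_min_on w E"
    have x: "x \<in> E" "\<And>y. y \<in> E \<Longrightarrow> w x \<le> w y"
      using arg_min_if_finite[OF Suc.prems(1) \<open>E \<noteq> {}\<close>, of w] arg_min_least[OF Suc.prems(1) \<open>E \<noteq> {}\<close>]
      by (auto simp: x_def)
    have E': "card (E - {x}) = n" "finite (E - {x})" "sum w E = w x + sum w (E - {x})"
      using Suc x by (auto simp: sum.remove)
    from Suc.hyps(1)[of "E - {x}"] E' Suc.hyps(2) Suc.prems False
    obtain R where R: "R \<subseteq> E - {x}" "card R = t" "t * sum w (E - {x}) \<le> n * sum w R"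
      by auto
    have "n * w x = (\<Sum>y\<in>E - {x}. w x)"
      using E' by simp
    also have "\<dots> \<le> sum w (E - {x})"
      using x by (intro sum_mono) auto
    finally have min: "n * w x \<le> sum w (E - {x})" .
    have "t * sum w E \<le> Suc n * sum w R"
    proof (cases "n = 0")
      case True
      then have "t = 0"
        using Suc.prems(2) Suc.hyps(2) False by linarith
      then show ?thesis by simp
    next
      case False
      have "n * (t * sum w E) = t * (n * w x) + n * (t * sum w (E - {x}))"
        by (simp add: E'(3) algebra_simps)
      also have "\<dots> \<le> t * sum w (E - {x}) + n * (t * sum w (E - {x}))"
        using min by (intro add_right_mono mult_left_mono) auto
      also have "\<dots> = Suc n * (t * sum w (E - {x}))"
        by simp
      also have "\<dots> \<le> Suc n * (n * sum w R)"
        using R(3) by (intro mult_left_mono) auto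
      also have "\<dots> = n * (Suc n * sum w R)"
        by (simp only: mult_ac)
      finally show ?thesis
        using False by simp
    qed
    with R Suc.hyps(2) show ?thesis by auto
  qed
qed

text \<open>One position chosen from each class of the pattern yields \<open>r\<close> pairwise
  different entries of \<open>B\<close>.\<close>

lemma few_elements_no_subpattern:
  assumes P: "is_pattern k l r P" "0 < r" and few: "card (elements_mat F) < r"
  shows "\<not> has_subpattern k l P F"
proof
  assume "has_subpattern k l P F"
  then obtain B where B: "is_submatrix B F" "has_pattern k l P B"
    by (auto simp: has_subpattern_def)
  then have carr: "B \<in> carrier_mat k l"
    and eq: "\<And>p q. p \<in> {..<k} \<times> {..<l} \<Longrightarrow> q \<in> {..<k} \<times> {..<l} \<Longrightarrow>
      B $$ p = B $$ q \<longleftrightarrow> (\<exists>T\<in>P. p \<in> T \<and> q \<in> T)"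
    by (auto simp: has_pattern_def)
  have part: "partition_on ({..<k} \<times> {..<l}) P" "card P = r"
    using P by (auto simp: is_pattern_def)
  have rep: "(SOME p. p \<in> T) \<in> T" "(SOME p. p \<in> T) \<in> {..<k} \<times> {..<l}" if "T \<in> P" for T
  proof -
    have "T \<noteq> {}" "T \<subseteq> {..<k} \<times> {..<l}"
      using part(1) that by (auto simp: partition_on_def)
    then show "(SOME p. p \<in> T) \<in> T" "(SOME p. p \<in> T) \<in> {..<k} \<times> {..<l}"
      using some_in_eq by blast+
  qed
  have uniq: "T = U" if "T \<in> P" "U \<in> P" "x \<in> T" "x \<in> U" for T U x
    using disjointD[OF partition_onD2[OF part(1)] that(1,2)] that(3,4) by blast
  have "inj_on (\<lambda>T. B $$ (SOME p. p \<in> T)) P"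
  proof (rule inj_onI)
    fix T T' assume T: "T \<in> P" "T' \<in> P" "B $$ (SOME p. p \<in> T) = B $$ (SOME p. p \<in> T')"
    then obtain U where U: "U \<in> P" "(SOME p. p \<in> T) \<in> U" "(SOME p. p \<in> T') \<in> U"
      using eq[OF rep(2)[OF T(1)] rep(2)[OF T(2)]] by blast
    show "T = T'"
      using uniq[OF T(1) U(1) rep(1)[OF T(1)] U(2)] uniq[OF T(2) U(1) rep(1)[OF T(2)] U(3)] by simp
  qed
  moreover have "(\<lambda>T. B $$ (SOME p. p \<in> T)) ` P \<subseteq> elements_mat B"
  proof
    fix x assume "x \<in> (\<lambda>T. B $$ (SOME p. p \<in> T)) ` P"
    then obtain T where T: "T \<in> P" "x = B $$ (SOME p. p \<in> T)" by blast
    define p where "p = (SOME p. p \<in> T)"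
    have "p \<in> {..<k} \<times> {..<l}" "x = B $$ p"
      unfolding p_def using rep(2)[OF T(1)] T(2) by blast+
    then show "x \<in> elements_mat B"
      using elements_matI[OF carr] by auto
  qed
  ultimately have "r \<le> card (elements_mat B)"
    using part(2) card_inj_on_le[of _ P "elements_mat B"] by (auto simp: elements_mat_def)
  moreover have "card (elements_mat B) \<le> card (elements_mat F)"
    using elements_submatrix[OF B(1)] by (intro card_mono) (auto simp: elements_mat_def)
  ultimately show False
    using few by simp
qed

text \<open>The \<open>t\<close> symbols of a heavy set \<open>R\<close> cover at least the fraction
  \<open>t / s\<close> of the positions. Only the other positions are overwritten, and the result
  has fewer symbols than the pattern has classes. The factor \<open>s\<close> keeps the estimate
  within the natural numbers.\<close>

lemma exists_close_in_Forb:
  fixes A :: "'a mat"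
  assumes P: "is_pattern k l (Suc t) P" "1 \<le> t" "t \<le> s" and A: "A \<in> matrices m n s"
  shows "\<exists>F\<in>Forb m n s k l P. s * mat_dist A F + t * (m * n) \<le> s * (m * n)"
proof -
  let ?E = "elements_mat A" and ?w = "\<lambda>c. card {p \<in> {..<m} \<times> {..<n}. A $$ p = c}"
  have carr: "A \<in> carrier_mat m n" and E: "finite ?E" "card ?E = s"
    using A by (auto simp: matrices_def elements_mat_def)
  obtain R where R: "R \<subseteq> ?E" "card R = t" "t * sum ?w ?E \<le> s * sum ?w R"
    using exists_heavy_subset[OF E(1), of t ?w] P(3) E(2) by auto
  have finR: "finite R"
    using R(1) E(1) finite_subset by blast
  have "R \<noteq> {}"
    using R(2) P(2) by auto
  then obtain c where c: "c \<in> R" by blast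
  define F where "F = mat m n (\<lambda>p. if A $$ p \<in> R then A $$ p else c)"
  have "elements_mat F \<subseteq> R"
    using c by (auto simp: F_def dest!: elements_matD)
  then have "card (elements_mat F) \<le> t"
    using R(2) card_mono[OF finR] by metis
  then have "F \<in> Forb m n s k l P"
    using few_elements_no_subpattern[OF P(1), of F] P(3) by (auto simp: Forb_def F_def)
  have sumw: "sum ?w X = card {p \<in> {..<m} \<times> {..<n}. A $$ p \<in> X}" if "finite X" for X
  proof -
    have "sum ?w X = card (\<Union>c\<in>X. {p \<in> {..<m} \<times> {..<n}. A $$ p = c})"
      using that by (intro card_UN_disjoint[symmetric]) auto
    then show ?thesis
      by (auto intro!: arg_cong[of _ _ card])
  qed
  have "{p \<in> {..<m} \<times> {..<n}. A $$ p \<in> ?E} = {..<m} \<times> {..<n}"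
    using elements_matI[OF carr] by auto
  then have sumE: "sum ?w ?E = m * n"
    using sumw[OF E(1)] by simp
  have "mat_dist A F \<le> card ({..<m} \<times> {..<n} - {p \<in> {..<m} \<times> {..<n}. A $$ p \<in> R})"
    unfolding mat_dist_def using carr by (intro card_mono) (auto simp: F_def)
  also have "\<dots> = m * n - sum ?w R"
    by (subst card_Diff_subset) (auto simp: sumw[OF finR])
  finally have "mat_dist A F + sum ?w R \<le> m * n"
    using sum_mono2[of ?E R ?w] R(1) E(1) sumE by simp
  then have "s * (mat_dist A F + sum ?w R) \<le> s * (m * n)"
    by (rule mult_left_mono) simp
  with R(3) sumE have "s * mat_dist A F + t * (m * n) \<le> s * (m * n)"
    by (simp add: distrib_left)
  with \<open>F \<in> Forb m n s k l P\<close> show ?thesis by blast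
qed

section \<open>Bounds for the extremal distance\<close>

lemma mat_dist_le: "A \<in> carrier_mat m n \<Longrightarrow> mat_dist A F \<le> m * n"
proof -
  assume "A \<in> carrier_mat m n"
  then have "mat_dist A F \<le> card ({..<m} \<times> {..<n})"
    unfolding mat_dist_def by (intro card_mono) auto
  then show ?thesis by simp
qed

lemma class_dist_le:
  assumes "A \<in> carrier_mat m n" "F \<in> \<F>"
  shows "class_dist A \<F> \<le> mat_dist A F"
proof -
  have "finite (mat_dist A ` \<F>)"
    by (rule finite_subset[of _ "{..m * n}"]) (use mat_dist_le[OF assms(1)] in auto)
  then show ?thesis
    unfolding class_dist_def using assms(2) by (intro Min_le) auto
qed

lemma class_dist_attained:
  assumes "A \<in> carrier_mat m n" "\<F> \<noteq> {}"
  shows "\<exists>F\<in>\<F>. class_dist A \<F> = mat_dist A F"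
proof -
  have "finite (mat_dist A ` \<F>)"
    by (rule finite_subset[of _ "{..m * n}"]) (use mat_dist_le[OF assms(1)] in auto)
  then have "Min (mat_dist A ` \<F>) \<in> mat_dist A ` \<F>"
    using assms(2) by (intro Min_in) auto
  then show ?thesis
    unfolding class_dist_def by blast
qed

text \<open>The matrix \<open>A\<close> has two uses: its distance gives the lower bound, and its
  existence makes the range of \<open>Max\<close> nonempty, so that the maximum is attained and
  inherits the upper bound of \<open>exists_close_in_Forb\<close>.\<close>

lemma max_forb_dist_bounds:
  fixes A :: "'a mat"
  assumes P: "is_pattern k l (Suc t) P" "1 \<le> t" "t \<le> s" and A: "A \<in> matrices m n s"
    and d: "\<And>F. F \<in> Forb m n s k l P \<Longrightarrow> d \<le> mat_dist A F"
  shows "d \<le> max_forb_dist TYPE('a) m n s k l P"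
    and "s * max_forb_dist TYPE('a) m n s k l P + t * (m * n) \<le> s * (m * n)"
proof -
  let ?\<F> = "Forb m n s k l P :: 'a mat set" and ?\<M> = "matrices m n s :: 'a mat set"
  let ?D = "(\<lambda>B. class_dist B ?\<F>) ` ?\<M>"
  have upper: "s * class_dist B ?\<F> + t * (m * n) \<le> s * (m * n)" "class_dist B ?\<F> \<le> m * n"
    if B: "B \<in> ?\<M>" for B
  proof -
    obtain F where F: "F \<in> ?\<F>" "s * mat_dist B F + t * (m * n) \<le> s * (m * n)"
      using exists_close_in_Forb[OF P B] by blast
    have carr: "B \<in> carrier_mat m n"
      using B by (simp add: matrices_def)
    note le = class_dist_le[OF carr F(1)]
    have "s * class_dist B ?\<F> \<le> s * mat_dist B F"
      using le by simp
    with F(2) show "s * class_dist B ?\<F> + t * (m * n) \<le> s * (m * n)" by linarith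
    show "class_dist B ?\<F> \<le> m * n"
      using le mat_dist_le[OF carr, of F] by simp
  qed
  have fin: "finite ?D"
    by (rule finite_subset[of _ "{..m * n}"]) (use upper(2) in auto)
  have "?\<F> \<noteq> {}"
    using exists_close_in_Forb[OF P A] by blast
  then have "d \<le> class_dist A ?\<F>"
    using class_dist_attained[of A m n ?\<F>] A d by (auto simp: matrices_def)
  also have "\<dots> \<le> max_forb_dist TYPE('a) m n s k l P"
    unfolding max_forb_dist_def using fin A by (intro Max_ge) auto
  finally show "d \<le> max_forb_dist TYPE('a) m n s k l P" .
  have "max_forb_dist TYPE('a) m n s k l P \<in> ?D"
    unfolding max_forb_dist_def using fin A by (intro Max_in) auto
  then show "s * max_forb_dist TYPE('a) m n s k l P + t * (m * n) \<le> s * (m * n)"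
    using upper(1) by auto
qed

text \<open>The complete blocks of the tiling cover at least \<open>(m - n0) * (n - N0)\<close>
  positions, which explains the shape of the lower bound. The upper bound is exact and carries no
  error term.\<close>

lemma max_forb_dist_asymptotics:
  fixes e :: real
  assumes P: "is_pattern k l (Suc t) P" "1 \<le> t" "t < s"
    and alphabet: "infinite (UNIV :: 'a set) \<or> s \<le> card (UNIV :: 'a set)" and e: "0 < e" "e < 1"
  shows "\<exists>n0>0. \<exists>N0>0. \<forall>m\<ge>n0. \<forall>n\<ge>N0.
    (1 - e) * (1 - real t / real s) * ((real m - real n0) * (real n - real N0))
      \<le> real (max_forb_dist TYPE('a) m n s k l P) \<and>
    real (max_forb_dist TYPE('a) m n s k l P) \<le> (1 - real t / real s) * (real m * real n)"
proof -
  define \<beta> where "\<beta> = 1 - real t / real s"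
  have \<beta>: "0 < \<beta>"
    using P by (simp add: \<beta>_def)
  obtain T :: "'a set" where T: "finite T" "card T = s"
    using alphabet infinite_arbitrarily_large[of UNIV s] obtain_subset_with_card_n[of s UNIV]
    by (metis UNIV_I card.infinite finite_subset subset_UNIV)
  have "0 < s"
    using P by simp
  \<comment> \<open>The absolute error \<open>e * \<beta>\<close> in the density becomes the
    relative factor \<open>1 - e\<close>.\<close>
  obtain n0 N0 and A :: "'a mat" where A: "0 < n0" "0 < N0" "A \<in> carrier_mat n0 N0"
    "card (elements_mat A) = s"
    and far: "\<And>F. F \<in> Forb n0 N0 s k l P \<Longrightarrow>
      (1 - real t / real s - e * \<beta>) * (real n0 * real N0) \<le> real (mat_dist A F)"
    using exists_block_far_from_Forb[OF P(1,2) T \<open>0 < s\<close>, of "e * \<beta>"] e \<beta> by auto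
  \<comment> \<open>Distances are integers, so rounding up to the natural number that
    \<open>tile_dist_ge\<close> expects is harmless.\<close>
  define d where "d = nat \<lceil>(1 - e) * \<beta> * (real n0 * real N0)\<rceil>"
  have d_ge: "(1 - e) * \<beta> * (real n0 * real N0) \<le> real d"
    unfolding d_def by linarith
  have d_le: "d \<le> mat_dist A F" if "F \<in> Forb n0 N0 s k l P" for F
  proof -
    have "(1 - e) * \<beta> * (real n0 * real N0) \<le> real (mat_dist A F)"
      using far[OF that, folded \<beta>_def] by (simp add: left_diff_distrib)
    then show ?thesis
      unfolding d_def by linarith
  qed
  have "(1 - e) * \<beta> * ((real m - real n0) * (real n - real N0)) \<le> real (max_forb_dist TYPE('a) m n s k l P)
      \<and> real (max_forb_dist TYPE('a) m n s k l P) \<le> \<beta> * (real m * real n)"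
    if mn: "n0 \<le> m" "N0 \<le> n" for m n
  proof
    have "elements_mat (tile A m n) = elements_mat A"
      using A mn by (intro elements_tile) auto
    then have tile: "tile A m n \<in> matrices m n s"
      using A by (simp add: matrices_def tile_def)
    note bounds = max_forb_dist_bounds[OF P(1,2) less_imp_le[OF P(3)] tile tile_dist_ge[OF A(3,1,2) d_le]]
    have *: "real p - real q \<le> real (p div q) * real q" if "0 < q" for p q :: nat
    proof -
      have "p < p div q * q + q"
        using that by (metis div_mult_mod_eq mod_less_divisor nat_add_left_cancel_less)
      then show ?thesis
        by (simp flip: of_nat_mult of_nat_add)
    qed
    have "(1 - e) * \<beta> * ((real m - real n0) * (real n - real N0))
        \<le> (1 - e) * \<beta> * ((real (m div n0) * real n0) * (real (n div N0) * real N0))"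
      using A mn e \<beta> by (intro mult_left_mono mult_mono *) auto
    also have "\<dots> = real (m div n0) * real (n div N0) * ((1 - e) * \<beta> * (real n0 * real N0))"
      by (simp only: mult_ac)
    also have "\<dots> \<le> real (m div n0) * real (n div N0) * real d"
      using d_ge by (rule mult_left_mono) simp
    also have "\<dots> = real ((m div n0) * (n div N0) * d)"
      by simp
    also have "\<dots> \<le> real (max_forb_dist TYPE('a) m n s k l P)"
      using bounds(1) by (simp only: of_nat_le_iff)
    finally show "(1 - e) * \<beta> * ((real m - real n0) * (real n - real N0))
      \<le> real (max_forb_dist TYPE('a) m n s k l P)" .
    have "real (s * max_forb_dist TYPE('a) m n s k l P + t * (m * n)) \<le> real (s * (m * n))"
      using bounds(2) by (simp only: of_nat_le_iff)
    then show "real (max_forb_dist TYPE('a) m n s k l P) \<le> \<beta> * (real m * real n)"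
      using \<open>0 < s\<close> by (simp add: \<beta>_def field_simps)
  qed
  then show ?thesis
    using A(1,2) unfolding \<beta>_def by blast
qed

theorem theorem1p1:
  fixes s r k l :: nat and b1 b2 :: real and P :: "(nat \<times> nat) set set"
  assumes "0 < r" and "r \<le> s"
    and "0 < b1" and "0 < b2"
    and "0 < k" and "0 < l"
    and "is_pattern k l r P" and "\<not> trivial_pattern P"
    and alphabet: "infinite (UNIV :: 'a set) \<or> s \<le> card (UNIV :: 'a set)"
  shows "\<exists>\<epsilon> :: nat \<Rightarrow> nat \<Rightarrow> real.
     ((\<lambda>(m, n). \<epsilon> m n) \<longlongrightarrow> 0) (bounded_ratio_filter b1 b2) \<and>
     (\<forall>m n. 0 < m \<longrightarrow> 0 < n \<longrightarrow> s \<le> m * n \<longrightarrow>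
        b1 \<le> real m / real n \<longrightarrow> real m / real n \<le> b2 \<longrightarrow>
        real (max_forb_dist TYPE('a) m n s k l P) =
          (1 + \<epsilon> m n) * ((real s - real r + 1) / real s) * (real m * real n))"
proof -
  define t where "t = r - 1"
  have "r \<noteq> 1"
    using assms(7,8) by (auto simp: is_pattern_def trivial_pattern_def)
  then have t: "r = Suc t" "1 \<le> t" "t < s"
    using assms(1,2) by (auto simp: t_def)
  have P: "is_pattern k l (Suc t) P"
    using assms(7) t(1) by simp
  define \<beta> where "\<beta> = 1 - real t / real s"
  have \<beta>: "0 < \<beta>" and \<beta>_eq: "(real s - real r + 1) / real s = \<beta>"
    using t by (auto simp: \<beta>_def field_simps)
  define f where "f m n = real (max_forb_dist TYPE('a) m n s k l P)" for m n
  \<comment> \<open>With the relative error as witness, the required equation holds by definition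
    for positive \<open>m\<close> and \<open>n\<close>; what remains is its limit.\<close>
  define \<epsilon> where "\<epsilon> m n = f m n / (\<beta> * (real m * real n)) - 1" for m n
  have "((\<lambda>(m, n). \<epsilon> m n) \<longlongrightarrow> 0) (at_top \<times>\<^sub>F at_top)"
  proof (rule tendstoI)
    fix e' :: real assume "0 < e'"
    \<comment> \<open>As \<open>e < e'\<close>, the lower bound for the quotient, which tends to
      \<open>1 - e\<close>, eventually exceeds \<open>1 - e'\<close>. The cap ensures
      \<open>e < 1\<close>, as \<open>max_forb_dist_asymptotics\<close> demands.\<close>
    define e where "e = min e' 1 / 2"
    have e: "0 < e" "e < 1" "e < e'"
      using \<open>0 < e'\<close> by (auto simp: e_def)
    obtain n0 N0 where n0: "0 < n0" "0 < N0"
      and bounds: "\<And>m n. n0 \<le> m \<Longrightarrow> N0 \<le> n \<Longrightarrow>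
        (1 - e) * \<beta> * ((real m - real n0) * (real n - real N0)) \<le> f m n \<and> f m n \<le> \<beta> * (real m * real n)"
      using max_forb_dist_asymptotics[OF P t(2,3) alphabet e(1,2)] unfolding \<beta>_def f_def by blast
    have fst: "filterlim fst at_top (at_top \<times>\<^sub>F at_top :: (nat \<times> nat) filter)"
      and snd: "filterlim snd at_top (at_top \<times>\<^sub>F at_top :: (nat \<times> nat) filter)"
      unfolding filterlim_def by (rule filtermap_fst_prod_filter filtermap_snd_prod_filter)+
    have lim: "(\<lambda>x. 1 - real c / real x) \<longlonglongrightarrow> 1 - 0" for c
      by (intro tendsto_intros lim_const_over_n)
    have "((\<lambda>p. (1 - e) * ((1 - real n0 / real (fst p)) * (1 - real N0 / real (snd p))))
        \<longlongrightarrow> (1 - e) * ((1 - 0) * (1 - 0))) (at_top \<times>\<^sub>F at_top)"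
      by (intro tendsto_mult tendsto_const filterlim_compose[OF lim fst] filterlim_compose[OF lim snd])
    then have "eventually (\<lambda>p. 1 - e' < (1 - e) * ((1 - real n0 / real (fst p)) * (1 - real N0 / real (snd p))))
        (at_top \<times>\<^sub>F at_top)"
      by (rule order_tendstoD) (use e in simp)
    moreover have "eventually (\<lambda>p. n0 \<le> fst p) (at_top \<times>\<^sub>F at_top :: (nat \<times> nat) filter)"
      using fst by (simp add: filterlim_at_top)
    moreover have "eventually (\<lambda>p. N0 \<le> snd p) (at_top \<times>\<^sub>F at_top :: (nat \<times> nat) filter)"
      using snd by (simp add: filterlim_at_top)
    ultimately show "eventually (\<lambda>p. dist (case p of (m, n) \<Rightarrow> \<epsilon> m n) 0 < e') (at_top \<times>\<^sub>F at_top)"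
    proof eventually_elim
      case (elim p)
      obtain m n where p: "p = (m, n)" by (cases p)
      have mn: "n0 \<le> m" "N0 \<le> n" "0 < m" "0 < n"
        using elim(2,3) n0 by (auto simp: p)
      have "(1 - real n0 / real m) * (1 - real N0 / real n) * (real m * real n)
          = (real m - real n0) * (real n - real N0)"
        using mn by (simp add: field_simps)
      then have "(1 - e) * ((1 - real n0 / real m) * (1 - real N0 / real n)) * (\<beta> * (real m * real n))
          = (1 - e) * \<beta> * ((real m - real n0) * (real n - real N0))"
        by (simp add: mult_ac)
      also have "\<dots> \<le> f m n"
        using bounds[OF mn(1,2)] by simp
      finally have "(1 - e) * ((1 - real n0 / real m) * (1 - real N0 / real n))
          \<le> f m n / (\<beta> * (real m * real n))"
        using mn \<beta> by (simp add: pos_le_divide_eq)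
      moreover have "f m n / (\<beta> * (real m * real n)) \<le> 1"
        using bounds[OF mn(1,2)] mn \<beta> by (simp add: pos_divide_le_eq)
      ultimately show ?case
        using elim(1) by (simp add: p \<epsilon>_def dist_real_def)
    qed
  qed
  then have "((\<lambda>(m, n). \<epsilon> m n) \<longlongrightarrow> 0) (bounded_ratio_filter b1 b2)"
    unfolding bounded_ratio_filter_def by (rule tendsto_mono[OF inf_le1])
  moreover have "real (max_forb_dist TYPE('a) m n s k l P)
      = (1 + \<epsilon> m n) * ((real s - real r + 1) / real s) * (real m * real n)" if "0 < m" "0 < n" for m n
    using that \<beta> by (simp add: \<beta>_eq \<epsilon>_def flip: f_def)
  ultimately show ?thesis
    by blast
qed

end
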